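(* Suppose $G$ is an amenable group and $\mathbf F=(F_k)_{k=1}^\infty$ is a tempered Følner sequence for $G$. Suppose further that $\mu$ is a Borel probability measure on $X$ that is $T$-invariant and ergodic, and let $n\in\mathbb{N}$. Then for almost all $\bar x\in X^n$ (with respect to the $n$-fold product measure $\mu\times\cdots\times\mu$), we have for all $f\in C(X)$ and all sequences $(\bar r_k)_{k=1}^\infty$ of $n$-tuples of positive numbers that decay $(X,\rho,H,L,\mathbf F)$-fast that $$\lim_{k\to\infty}\alpha_{B(\bar x;\bar r_k)}\left(\operatorname{Avg}_{F_k}f\right)=\int f\,\mathrm d\mu.$$
   Context: $(X,\rho)$ is a compact metric space and $C(X)$ is the space of continuous functions $X\to\mathbb{C}$. $G$ is a discrete group and $T:G\curvearrowright X$ is a left action by homeomorphisms $(T_g)_{g\in G}$ ($T_{g_1}\circ T_{g_2}=T_{g_1g_2}$, $T_{1_G}=\mathrm{id}_X$) which are Hölder with modulus of Hölder continuity $(H,L)$: $H,L:G\to(0,\infty)$ are functions with $\rho(T_gx,T_gy)\le L(g)\cdot\rho(x,y)^{H(g)}$ for all $g\in G$, $x,y\in X$. A sequence $(F_k)_{k=1}^\infty$ of nonempty finite subsets of $G$ is Følner if $\lim_{k\to\infty}|F_k\Delta gF_k|/|F_k|=0$ for all $g\in G$; it is tempered if there is a constant $c>0$ with $\left|\bigcup_{j=1}^{k-1}F_j^{-1}F_k\right|\le c|F_k|$ for all $k\ge2$. For a finite nonempty $F\subseteq G$ and $f:X\to\mathbb{C}$, $\operatorname{Avg}_Ff:=\frac1{|F|}\sum_{g\in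 F}f\circ T_g$. For $x\in X,r>0$, $B(x;r)=\{y\in X:\rho(x,y)<r\}$; for $\bar x\in X^n$, $\bar r\in(0,\infty)^n$, $B(\bar x;\bar r):=\bigcup_{h=1}^nB(x^{(h)};r^{(h)})$. For a measurable $E\subseteq X$ with $\mu(E)>0$, $\alpha_E(f):=\frac1{\mu(E)}\int_Ef\,\mathrm d\mu$. A sequence $(\bar r_k)_{k=1}^\infty$ of $n$-tuples of positive numbers decays $(X,\rho,H,L,\mathbf F)$-fast if for all $h\in\{1,\ldots,n\}$ we have $\lim_{k\to\infty}r_k^{(h)}=0$ and, for all $\delta\in(0,\infty)$, $\lim_{k\to\infty}\frac{|\{g\in F_k:L(g)\cdot(r_k^{(h)})^{H(g)}>\delta\}|}{|F_k|}=0$. *)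

theory Defs
  imports "HOL-Probability.Probability" "HOL-Algebra.Group_Action"
begin

text \<open>
  Sequences indexed by the positive integers are rendered as functions on \<open>nat\<close> whose value at
  \<open>0\<close> is never constrained. An \<open>n\<close>-tuple is a function on \<open>{1..n}\<close>. Points of \<open>X^n\<close> are elements of
  the library product space over the index set \<open>{1..n}\<close>. The compact metric space \<open>X\<close> is a
  type of class \<open>metric_space\<close> whose universe is compact.
\<close>

definition folner_seq :: "('g, 'b) monoid_scheme \<Rightarrow> (nat \<Rightarrow> 'g set) \<Rightarrow> bool" where
  "folner_seq G F \<longleftrightarrow>
     (\<forall>k\<ge>1. finite (F k) \<and> F k \<noteq> {} \<and> F k \<subseteq> carrier G) \<and>
     (\<forall>g\<in>carrier G.
        (\<lambda>k. real (card (sym_diff (F k) (g <#\<^bsub>G\<^esub> F k))) / real (card (F k))) \<longlonglongrightarrow> 0)"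

definition tempered_seq :: "('g, 'b) monoid_scheme \<Rightarrow> (nat \<Rightarrow> 'g set) \<Rightarrow> bool" where
  "tempered_seq G F \<longleftrightarrow>
     (\<exists>c>0. \<forall>k\<ge>2.
        real (card (\<Union>j\<in>{1..k-1}. (set_inv\<^bsub>G\<^esub> (F j)) <#>\<^bsub>G\<^esub> F k)) \<le> c * real (card (F k)))"

definition amenable :: "('g, 'b) monoid_scheme \<Rightarrow> bool" where
  "amenable G \<longleftrightarrow> group G \<and> (\<exists>F. folner_seq G F)"

text \<open>Modulus of Hoelder continuity. Since \<open>H g > 0\<close>, the convention \<open>0 powr a = 0\<close> agrees with
  the usual value of \<open>0\<close> raised to a positive power.\<close>

definition holder_modulus ::
  "('g, 'b) monoid_scheme \<Rightarrow> ('g \<Rightarrow> 'x::metric_space \<Rightarrow> 'x) \<Rightarrow> ('g \<Rightarrow> real) \<Rightarrow> ('g \<Rightarrow> real) \<Rightarrow> bool" where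
  "holder_modulus G T H L \<longleftrightarrow>
     (\<forall>g\<in>carrier G. H g > 0 \<and> L g > 0 \<and>
        (\<forall>x y. dist (T g x) (T g y) \<le> L g * dist x y powr H g))"

definition invariant_measure ::
  "('g, 'b) monoid_scheme \<Rightarrow> ('g \<Rightarrow> 'x \<Rightarrow> 'x) \<Rightarrow> 'x measure \<Rightarrow> bool" where
  "invariant_measure G T M \<longleftrightarrow>
     (\<forall>g\<in>carrier G. \<forall>A\<in>sets M. emeasure M (T g -` A \<inter> space M) = emeasure M A)"

definition ergodic_measure ::
  "('g, 'b) monoid_scheme \<Rightarrow> ('g \<Rightarrow> 'x \<Rightarrow> 'x) \<Rightarrow> 'x measure \<Rightarrow> bool" where
  "ergodic_measure G T M \<longleftrightarrow>
     (\<forall>A\<in>sets M. (\<forall>g\<in>carrier G. T g -` A \<inter> space M = A) \<longrightarrow> measure M A = 0 \<or> measure M A = 1)"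

definition Avg :: "('g \<Rightarrow> 'x \<Rightarrow> 'x) \<Rightarrow> 'g set \<Rightarrow> ('x \<Rightarrow> complex) \<Rightarrow> 'x \<Rightarrow> complex" where
  "Avg T F f = (\<lambda>x. (1 / of_nat (card F)) * (\<Sum>g\<in>F. f (T g x)))"

text \<open>Only meaningful when \<open>E\<close> has positive measure; otherwise division by zero makes it \<open>0\<close>.\<close>

definition alpha :: "'x measure \<Rightarrow> 'x set \<Rightarrow> ('x \<Rightarrow> complex) \<Rightarrow> complex" where
  "alpha M E f = (1 / of_real (measure M E)) * (LINT x:E|M. f x)"

definition multi_ball :: "nat \<Rightarrow> (nat \<Rightarrow> 'x::metric_space) \<Rightarrow> (nat \<Rightarrow> real) \<Rightarrow> 'x set" where
  "multi_ball n x r = (\<Union>h\<in>{1..n}. ball (x h) (r h))"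

text \<open>The radius \<open>r k h\<close> is the \<open>h\<close>-th entry of the \<open>k\<close>-th tuple.\<close>

definition decays_fast ::
  "('g \<Rightarrow> real) \<Rightarrow> ('g \<Rightarrow> real) \<Rightarrow> (nat \<Rightarrow> 'g set) \<Rightarrow> nat \<Rightarrow> (nat \<Rightarrow> nat \<Rightarrow> real) \<Rightarrow> bool" where
  "decays_fast H L F n r \<longleftrightarrow>
     (\<forall>h\<in>{1..n}. (\<lambda>k. r k h) \<longlonglongrightarrow> 0 \<and>
        (\<forall>\<delta>>0. (\<lambda>k. real (card {g \<in> F k. L g * r k h powr H g > \<delta>}) / real (card (F k))) \<longlonglongrightarrow> 0))"

end

theory Submission
  imports Defs
begin

text \<open>
  Lindenstrauss' pointwise ergodic theorem gives, for almost every point, convergence of the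
  averages of every bounded measurable function. Applied to the indicators of countably many fine
  finite partitions of \<open>X\<close>, it yields a full-measure set of points, each in the support of \<open>\<mu>\<close>, at
  which the averages of all continuous functions converge. Fast decay of the radii makes the
  oscillation of \<open>Avg T (F k) f\<close> on each ball tend to zero, so averaging over the balls does not
  change the limit.

  The weak type (1,1) inequality behind the ergodic theorem rests on a covering lemma for tempered
  sequences. In place of Lindenstrauss' random selection of translates \<open>F k a\<close>, the selection here
  is greedy and deterministic: translates are treated in order of decreasing \<open>k\<close>, each chosen one
  spreads the weight \<open>1 / |F k|\<close> on its elements, and a translate is discarded exactly when the
  weights of the chosen larger translates that it meets add up to at least 1.
\<close>

section \<open>A covering lemma for tempered sequences\<close>

text \<open>Recursion along decreasing \<open>m\<close>: whether \<open>a\<close> enters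
  \<open>S\<close> depends only on chosen elements of strictly larger \<open>m\<close>, so elements
  with equal \<open>m\<close> never influence each other and a later decision cannot disturb an
  earlier one.\<close>

lemma level_selection:
  fixes m :: "'a \<Rightarrow> nat"
  assumes "finite D"
  shows "\<exists>S\<subseteq>D. \<forall>a\<in>D. a \<in> S \<longleftrightarrow> P a {b \<in> S. m b > m a}"
  using assms
\<comment> \<open>The rule adds an element of largest rank last; the negation makes that an element
  of least \<open>m\<close>. The added element may already be present, hence the split on
  \<open>x \<in> D\<close>.\<close>
proof (induction D rule: finite_ranking_induct[where f = "\<lambda>a. - int (m a)"])
  case empty
  then show ?case by simp
next
  case (insert x D)
  then obtain S where S: "S \<subseteq> D" "\<forall>a\<in>D. a \<in> S \<longleftrightarrow> P a {b \<in> S. m b > m a}"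
    by blast
  have le: "m x \<le> m y" if "y \<in> D" for y
    using insert.hyps(2)[OF that] by simp
  show ?case
  proof (cases "x \<in> D")
    case True
    then show ?thesis using S by (simp add: insert_absorb) blast
  next
    case False
    define S' where "S' = (if P x {b \<in> S. m b > m x} then insert x S else S)"
    have above: "{b \<in> S'. m b > m a} = {b \<in> S. m b > m a}" if "a \<in> insert x D" for a
    proof -
      have "m x \<le> m a" using le that by auto
      then show ?thesis unfolding S'_def by auto
    qed
    have mem: "a \<in> S' \<longleftrightarrow> a \<in> S" if "a \<in> D" for a
      using that False unfolding S'_def by auto
    have "x \<in> S' \<longleftrightarrow> P x {b \<in> S'. m b > m x}"
      using above[of x] False S(1) unfolding S'_def by auto
    then have "\<forall>a\<in>insert x D. a \<in> S' \<longleftrightarrow> P a {b \<in> S'. m b > m a}"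
      using S(2) above mem by auto
    moreover have "S' \<subseteq> insert x D"
      using S(1) unfolding S'_def by auto
    ultimately show ?thesis by blast
  qed
qed

text \<open>In the factor \<open>1 + c\<close>, the 1 counts the chosen elements and
  \<open>c\<close> the discarded ones charged to each of them. In the bound 2 at \<open>g\<close>,
  the chosen translates through \<open>g\<close> of the smallest occurring \<open>m\<close>
  contribute at most 1, since at most \<open>card (F k)\<close> translates of \<open>F k\<close>
  contain \<open>g\<close>, and those of larger \<open>m\<close> contribute less than 1.\<close>

lemma (in group) tempered_covering:
  fixes F :: "nat \<Rightarrow> 'a set" and m :: "'a \<Rightarrow> nat" and c :: real
  assumes F: "\<And>k. k \<ge> 1 \<Longrightarrow> finite (F k) \<and> F k \<noteq> {} \<and> F k \<subseteq> carrier G"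
    and temp: "\<And>k. k \<ge> 2 \<Longrightarrow> card (\<Union>j\<in>{1..k-1}. (set_inv (F j)) <#> F k) \<le> c * card (F k)"
    and c: "c \<ge> 0"
    and D: "finite D" "D \<subseteq> carrier G" and m: "\<And>a. a \<in> D \<Longrightarrow> m a \<ge> 1"
  shows "\<exists>S\<subseteq>D. card D \<le> (1 + c) * card S \<and>
           (\<forall>g\<in>carrier G. (\<Sum>a | a \<in> S \<and> g \<in> F (m a) #> a. 1 / card (F (m a))) \<le> 2)"
proof -
  define w where "w = (\<lambda>a. 1 / real (card (F (m a))))"
  define meet where "meet = (\<lambda>a b. (F (m a) #> a) \<inter> (F (m b) #> b) \<noteq> {})"
  have w0: "w a \<ge> 0" for a unfolding w_def by simp
  obtain S where S: "S \<subseteq> D"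
    and mem: "\<And>a. a \<in> D \<Longrightarrow> a \<in> S \<longleftrightarrow> sum w {b \<in> {b \<in> S. m b > m a}. meet a b} < 1"
    using level_selection[OF D(1), of "\<lambda>a B. sum w {b \<in> B. meet a b} < 1" m] by blast
  have finS: "finite S" using S D(1) finite_subset by blast
  \<comment> \<open>Each discarded \<open>a\<close> carries load at least 1, and temperedness bounds how many \<open>a\<close> a chosen \<open>b\<close>
     can be charged for.\<close>
  have charge: "card {a \<in> D - S. m b > m a \<and> meet a b} * w b \<le> c" if b: "b \<in> S" for b
  proof -
    have bD: "b \<in> D" and bc: "b \<in> carrier G" using b S D(2) by auto
    have Fb: "finite (F (m b))" "F (m b) \<noteq> {}" "F (m b) \<subseteq> carrier G" using F[OF m[OF bD]] by auto
    let ?A = "{a \<in> D - S. m b > m a \<and> meet a b}"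
    let ?U = "\<Union>j\<in>{1..m b-1}. (set_inv (F j)) <#> F (m b)"
    show ?thesis
    proof (cases "m b \<ge> 2")
      \<comment> \<open>For \<open>m b = 1\<close> there is no smaller index
        \<open>m a \<ge> 1\<close>, so nothing is charged to \<open>b\<close>; temperedness speaks
        only from 2 on.\<close>
      case False
      then have "?A = {}" using m[OF bD] m by force
      then show ?thesis using c by (simp only: card.empty)
    next
      case True
      have finU: "finite ?U"
        using F Fb(1) by (auto simp: set_mult_def SET_INV_def)
      \<comment> \<open>If the translates share \<open>p \<otimes> a = q \<otimes> b\<close>, then
        \<open>a = (inv p \<otimes> q) \<otimes> b\<close> with \<open>p\<close> from the earlier
        set \<open>F (m a)\<close>. So every \<open>a\<close> charged to \<open>b\<close> lies in
        the right translate by \<open>b\<close> of the set that temperedness bounds.\<close>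
      have "?A \<subseteq> (\<lambda>u. u \<otimes> b) ` ?U"
      proof
        fix a assume a: "a \<in> ?A"
        then have aD: "a \<in> D" and ac: "a \<in> carrier G" using D(2) by auto
        have "meet a b" using a by simp
        then obtain p q where pq: "p \<in> F (m a)" "q \<in> F (m b)" "p \<otimes> a = q \<otimes> b"
          unfolding meet_def r_coset_def by auto
        have pc: "p \<in> carrier G" "q \<in> carrier G"
          using pq F[OF m[OF aD]] Fb by auto
        have "a = inv p \<otimes> (p \<otimes> a)" using pc ac by (simp add: m_assoc[symmetric])
        also have "\<dots> = (inv p \<otimes> q) \<otimes> b" using pq(3) pc bc by (simp add: m_assoc)
        finally have "a = (inv p \<otimes> q) \<otimes> b" .
        moreover have "inv p \<otimes> q \<in> ?U"
        proof (rule UN_I[of "m a"])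
          show "m a \<in> {1..m b - 1}" using a m[OF aD] by auto
          show "inv p \<otimes> q \<in> set_inv (F (m a)) <#> F (m b)"
            using pq unfolding set_mult_def SET_INV_def by auto
        qed
        ultimately show "a \<in> (\<lambda>u. u \<otimes> b) ` ?U" by (rule image_eqI)
      qed
      then have "card ?A \<le> card ?U"
        using finU by (meson card_image_le card_mono finite_imageI le_trans)
      also have "real (card ?U) \<le> c * card (F (m b))" using temp[OF True] .
      finally have "real (card ?A) \<le> c * card (F (m b))" by simp
      then show ?thesis
        using Fb unfolding w_def by (simp add: field_simps card_gt_0_iff)
    qed
  qed
  have "real (card (D - S)) \<le> (\<Sum>a\<in>D - S. sum w {b \<in> S. m b > m a \<and> meet a b})"
  proof -
    have "1 \<le> sum w {b \<in> S. m b > m a \<and> meet a b}" if "a \<in> D - S" for a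
      using mem[of a] that by (auto simp: conj_assoc not_less)
    from sum_mono[of "D - S" "\<lambda>_. 1", OF this] show ?thesis by simp
  qed
  also have "\<dots> = (\<Sum>a\<in>D - S. \<Sum>b\<in>S. if m b > m a \<and> meet a b then w b else 0)"
    using finS by (simp add: sum.inter_filter)
  also have "\<dots> = (\<Sum>b\<in>S. \<Sum>a\<in>D - S. if m b > m a \<and> meet a b then w b else 0)"
    by (rule sum.swap)
  also have "\<dots> = (\<Sum>b\<in>S. card {a \<in> D - S. m b > m a \<and> meet a b} * w b)"
    using D(1) by (intro sum.cong refl) (simp add: sum.inter_filter[symmetric])
  also have "\<dots> \<le> (\<Sum>b\<in>S. c)" by (intro sum_mono charge)
  finally have "real (card (D - S)) \<le> c * card S" by (simp add: mult.commute)
  moreover have "real (card D) = card (D - S) + card S"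
    using S D(1) finS by (simp add: card_Diff_subset card_mono)
  ultimately have count: "card D \<le> (1 + c) * card S" by (simp add: algebra_simps)
  have load: "sum w {a \<in> S. g \<in> F (m a) #> a} \<le> 2" if g: "g \<in> carrier G" for g
  proof (cases "{a \<in> S. g \<in> F (m a) #> a} = {}")
    case True
    then show ?thesis by (simp only: sum.empty)
  next
    case False
    define Z where "Z = {a \<in> S. g \<in> F (m a) #> a}"
    have Zfin: "finite Z" unfolding Z_def using finS by simp
    \<comment> \<open>All larger chosen translates through \<open>g\<close> meet the smallest one, which was not discarded.\<close>
    define a where "a = arg_min_on m Z"
    have aZ: "a \<in> Z" and amin: "\<And>b. b \<in> Z \<Longrightarrow> m a \<le> m b"
      using False Zfin unfolding a_def Z_def[symmetric]
      by (auto intro: arg_min_if_finite(1) arg_min_least)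
    have aS: "a \<in> S" and aD: "a \<in> D" and ga: "g \<in> F (m a) #> a"
      using aZ S unfolding Z_def by auto
    \<comment> \<open>\<open>?Z1\<close> ranges over all of \<open>S\<close>: it is the sum tested
      when \<open>a\<close> was accepted, and the larger translates through \<open>g\<close> form a
      part of it.\<close>
    let ?Z1 = "{b \<in> S. m b > m a \<and> meet a b}" and ?Z2 = "{b \<in> Z. m b = m a}"
    have "Z \<subseteq> ?Z1 \<union> ?Z2"
    proof
      fix b assume b: "b \<in> Z"
      then have "meet a b" using ga unfolding meet_def Z_def by auto
      then show "b \<in> ?Z1 \<union> ?Z2" using b amin[OF b] unfolding Z_def by auto
    qed
    then have "sum w Z \<le> sum w (?Z1 \<union> ?Z2)"
      using finS Zfin w0 by (intro sum_mono2) auto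
    also have "\<dots> = sum w ?Z1 + sum w ?Z2"
      using finS Zfin by (intro sum.union_disjoint) auto
    also have "sum w ?Z1 \<le> 1"
      using mem[OF aD] aS by (auto simp: conj_assoc)
    also have "sum w ?Z2 \<le> 1"
    proof -
      have Fa: "finite (F (m a))" "F (m a) \<noteq> {}" "F (m a) \<subseteq> carrier G" using F[OF m[OF aD]] by auto
      have "?Z2 \<subseteq> (\<lambda>p. inv p \<otimes> g) ` F (m a)"
      proof
        fix b assume b: "b \<in> ?Z2"
        then obtain p where p: "p \<in> F (m a)" "g = p \<otimes> b"
          unfolding Z_def r_coset_def by auto
        have "b \<in> carrier G" using b S D(2) unfolding Z_def by auto
        moreover have "p \<in> carrier G" using p Fa by auto
        ultimately have "b = inv p \<otimes> g" using p(2) by (simp add: m_assoc[symmetric])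
        then show "b \<in> (\<lambda>p. inv p \<otimes> g) ` F (m a)" using p(1) by (rule image_eqI)
      qed
      then have "card ?Z2 \<le> card (F (m a))"
        using Fa(1) by (meson card_image_le card_mono finite_imageI le_trans)
      moreover have "sum w ?Z2 = card ?Z2 / card (F (m a))"
        unfolding w_def by simp
      moreover have "card (F (m a)) > 0" using Fa by (simp add: card_gt_0_iff)
      ultimately show ?thesis by (simp add: divide_le_eq)
    qed
    finally show ?thesis unfolding Z_def by simp
  qed
  show ?thesis using S count load unfolding w_def by blast
qed

text \<open>On each chosen translate the mean of \<open>\<phi>\<close> is at least \<open>l\<close>.
  Summing over \<open>S\<close> and exchanging the sums weights each point of \<open>K\<close> by
  its load, at most 2; passing from \<open>S\<close> back to \<open>D\<close> costs the factor
  \<open>1 + c\<close>.\<close>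

lemma (in group) discrete_maximal_inequality:
  fixes F :: "nat \<Rightarrow> 'a set" and m :: "'a \<Rightarrow> nat" and c l :: real and \<phi> :: "'a \<Rightarrow> real"
  assumes F: "\<And>k. k \<ge> 1 \<Longrightarrow> finite (F k) \<and> F k \<noteq> {} \<and> F k \<subseteq> carrier G"
    and temp: "\<And>k. k \<ge> 2 \<Longrightarrow> card (\<Union>j\<in>{1..k-1}. (set_inv (F j)) <#> F k) \<le> c * card (F k)"
    and c: "c \<ge> 0"
    and D: "finite D" "D \<subseteq> carrier G" and m: "\<And>a. a \<in> D \<Longrightarrow> m a \<ge> 1"
    and K: "finite K" "K \<subseteq> carrier G" "\<And>a. a \<in> D \<Longrightarrow> F (m a) #> a \<subseteq> K"
    and \<phi>: "\<And>g. g \<in> K \<Longrightarrow> \<phi> g \<ge> 0"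
    and l: "l \<ge> 0" "\<And>a. a \<in> D \<Longrightarrow> l * card (F (m a)) \<le> (\<Sum>g\<in>F (m a). \<phi> (g \<otimes> a))"
  shows "l * card D \<le> 2 * (1 + c) * sum \<phi> K"
proof -
  have "\<exists>S\<subseteq>D. card D \<le> (1 + c) * card S \<and>
      (\<forall>g\<in>carrier G. (\<Sum>a | a \<in> S \<and> g \<in> F (m a) #> a. 1 / card (F (m a))) \<le> 2)"
    using F temp c D m by (rule tempered_covering)
  then obtain S where S: "S \<subseteq> D" "card D \<le> (1 + c) * card S"
    and load: "\<And>g. g \<in> carrier G \<Longrightarrow> (\<Sum>a | a \<in> S \<and> g \<in> F (m a) #> a. 1 / card (F (m a))) \<le> 2"
    by (elim exE conjE) simp
  have finS: "finite S" using S D(1) finite_subset by blast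
  have "l * card S = (\<Sum>a\<in>S. l)" by simp
  also have "\<dots> \<le> (\<Sum>a\<in>S. \<Sum>g\<in>F (m a) #> a. \<phi> g / card (F (m a)))"
  proof (rule sum_mono)
    fix a assume "a \<in> S"
    then have aD: "a \<in> D" and ac: "a \<in> carrier G" using S D by auto
    have Fa: "finite (F (m a))" "F (m a) \<noteq> {}" "F (m a) \<subseteq> carrier G" using F[OF m[OF aD]] by auto
    have "F (m a) #> a = (\<lambda>g. g \<otimes> a) ` F (m a)" unfolding r_coset_def by auto
    moreover have "inj_on (\<lambda>g. g \<otimes> a) (F (m a))"
      using Fa(3) ac by (intro inj_onI) (meson right_cancel subsetD)
    ultimately have "(\<Sum>g\<in>F (m a) #> a. \<phi> g / card (F (m a))) = (\<Sum>g\<in>F (m a). \<phi> (g \<otimes> a)) / card (F (m a))"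
      by (simp add: sum.reindex sum_divide_distrib)
    moreover have "card (F (m a)) > 0" using Fa by (simp add: card_gt_0_iff)
    ultimately show "l \<le> (\<Sum>g\<in>F (m a) #> a. \<phi> g / card (F (m a)))"
      using l(2)[OF aD] by (simp add: le_divide_eq)
  qed
  also have "\<dots> = (\<Sum>a\<in>S. \<Sum>g\<in>K. if g \<in> F (m a) #> a then \<phi> g / card (F (m a)) else 0)"
  proof (rule sum.cong[OF refl])
    fix a assume "a \<in> S"
    then have "F (m a) #> a \<subseteq> K" using K(3) S(1) by auto
    then have "F (m a) #> a = {g \<in> K. g \<in> F (m a) #> a}" by auto
    then have "(\<Sum>g\<in>F (m a) #> a. \<phi> g / card (F (m a))) = (\<Sum>g | g \<in> K \<and> g \<in> F (m a) #> a. \<phi> g / card (F (m a)))"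
      by simp
    then show "(\<Sum>g\<in>F (m a) #> a. \<phi> g / card (F (m a)))
        = (\<Sum>g\<in>K. if g \<in> F (m a) #> a then \<phi> g / card (F (m a)) else 0)"
      using K(1) by (simp add: sum.inter_filter)
  qed
  also have "\<dots> = (\<Sum>g\<in>K. \<Sum>a\<in>S. if g \<in> F (m a) #> a then \<phi> g / card (F (m a)) else 0)"
    by (rule sum.swap)
  also have "\<dots> = (\<Sum>g\<in>K. \<phi> g * (\<Sum>a | a \<in> S \<and> g \<in> F (m a) #> a. 1 / card (F (m a))))"
    using finS by (simp add: sum.inter_filter sum_distrib_left if_distrib cong: if_cong)
  also have "\<dots> \<le> (\<Sum>g\<in>K. \<phi> g * 2)"
    using K(2) \<phi> load by (intro sum_mono mult_left_mono) auto
  finally have "l * card S \<le> 2 * sum \<phi> K" by (simp add: sum_distrib_right[symmetric] mult.commute)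
  then have "(1 + c) * (l * card S) \<le> (1 + c) * (2 * sum \<phi> K)"
    using c by (intro mult_left_mono) auto
  moreover have "l * card D \<le> l * ((1 + c) * card S)"
    using S(2) l(1) by (intro mult_left_mono)
  ultimately show ?thesis by (simp add: algebra_simps)
qed

section \<open>Measure preserving actions\<close>

text \<open>Real counterpart of \<open>Avg\<close>: the ergodic theorem is proved for real
  functions, and \<open>Avg\<close> is reduced to it through indicator functions.\<close>

definition real_avg :: "('g \<Rightarrow> 'x \<Rightarrow> 'x) \<Rightarrow> 'g set \<Rightarrow> ('x \<Rightarrow> real) \<Rightarrow> 'x \<Rightarrow> real" where
  "real_avg T F f x = (\<Sum>g\<in>F. f (T g x)) / card F"

lemma abs_sum_diff_le_card_sym_diff:
  fixes f :: "'a \<Rightarrow> real"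
  assumes "finite A" "finite B" and bnd: "\<And>x. x \<in> A \<union> B \<Longrightarrow> \<bar>f x\<bar> \<le> C"
  shows "\<bar>sum f A - sum f B\<bar> \<le> C * card (sym_diff A B)"
proof -
  have "sum f A = sum f (A - B) + sum f (A \<inter> B)" "sum f B = sum f (B - A) + sum f (A \<inter> B)"
    using assms(1,2) sum.Int_Diff[of A f B] sum.Int_Diff[of B f A] by (simp_all add: Int_commute)
  then have "\<bar>sum f A - sum f B\<bar> \<le> \<bar>sum f (A - B)\<bar> + \<bar>sum f (B - A)\<bar>" by linarith
  also have "\<dots> \<le> (\<Sum>x\<in>A - B. \<bar>f x\<bar>) + (\<Sum>x\<in>B - A. \<bar>f x\<bar>)"
    by (intro add_mono sum_abs)
  also have "\<dots> = (\<Sum>x\<in>sym_diff A B. \<bar>f x\<bar>)"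
    using assms(1,2) by (intro sum.union_disjoint[symmetric]) auto
  also have "\<dots> \<le> (\<Sum>x\<in>sym_diff A B. C)" using bnd by (intro sum_mono) auto
  finally show ?thesis by (simp add: mult.commute)
qed

locale pmp_action = prob_space M + group_action G "space M" T
  for M :: "'x measure" and G (structure) and T +
  assumes action_measurable [measurable]: "g \<in> carrier G \<Longrightarrow> T g \<in> measurable M M"
    and action_preserves: "g \<in> carrier G \<Longrightarrow> distr M M (T g) = M"

sublocale pmp_action \<subseteq> group G
  using group_hom by (rule group_hom.axioms(1))

context pmp_action
begin

lemma action_in_space: "g \<in> carrier G \<Longrightarrow> x \<in> space M \<Longrightarrow> T g x \<in> space M"
  using element_image by blast

lemma integral_action:
  fixes f :: "'x \<Rightarrow> 'c::{banach, second_countable_topology}"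
  assumes "g \<in> carrier G" "f \<in> borel_measurable M"
  shows "(\<integral>x. f (T g x) \<partial>M) = integral\<^sup>L M f"
  using integral_distr[OF action_measurable assms(2)] action_preserves assms(1) by simp

lemma integrable_action:
  fixes f :: "'x \<Rightarrow> 'c::{banach, second_countable_topology}"
  assumes "g \<in> carrier G" "integrable M f"
  shows "integrable M (\<lambda>x. f (T g x))"
  using integrable_distr[OF action_measurable, of g f] action_preserves assms by simp

lemma AE_action: "g \<in> carrier G \<Longrightarrow> AE x in M. P x \<Longrightarrow> AE x in M. P (T g x)"
  using AE_distrD[OF action_measurable, of g P] action_preserves[of g] by metis

lemma real_avg_measurable [measurable]:
  assumes "K \<subseteq> carrier G" "f \<in> borel_measurable M"
  shows "real_avg T K f \<in> borel_measurable M"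
proof -
  have "(\<lambda>x. f (T g x)) \<in> borel_measurable M" if "g \<in> K" for g
    using that assms action_measurable by (intro measurable_compose[OF _ assms(2)]) auto
  then show ?thesis unfolding real_avg_def by measurable
qed

lemma integrable_bounded:
  fixes f :: "'x \<Rightarrow> real"
  assumes "f \<in> borel_measurable M" "\<And>x. x \<in> space M \<Longrightarrow> \<bar>f x\<bar> \<le> B"
  shows "integrable M f"
  using assms by (intro integrable_const_bound[where B = B]) auto

text \<open>Ergodicity is applied to the set where \<open>w\<close> exceeds its mean. Full measure
  would make the mean exceed itself; measure zero leaves \<open>w\<close> at or below its mean
  almost everywhere, which forces equality.\<close>

lemma strictly_invariant_AE_const:
  fixes w :: "'x \<Rightarrow> real"
  assumes erg: "ergodic_measure G T M"
    and w: "w \<in> borel_measurable M" "\<And>x. x \<in> space M \<Longrightarrow> \<bar>w x\<bar> \<le> B"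
    and inv: "\<And>h x. h \<in> carrier G \<Longrightarrow> x \<in> space M \<Longrightarrow> w (T h x) = w x"
  shows "AE x in M. w x = (\<integral>x. w x \<partial>M)"
proof -
  define m where "m = (\<integral>x. w x \<partial>M)"
  have int: "integrable M w" using w by (rule integrable_bounded)
  note w(1)[measurable]
  define A where "A = {x \<in> space M. w x > m}"
  have A[measurable]: "A \<in> sets M" unfolding A_def by measurable
  have "T g -` A \<inter> space M = A" if "g \<in> carrier G" for g
    using inv[OF that] action_in_space[OF that] unfolding A_def by auto
  then have "\<forall>g\<in>carrier G. T g -` A \<inter> space M = A" by simp
  then have "measure M A = 0 \<or> measure M A = 1"
    using erg A by (simp add: ergodic_measure_def)
  moreover have "measure M A \<noteq> 1"
  proof
    assume "measure M A = 1"
    then have "AE x in M. x \<in> A" by (rule AE_prob_1)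
    then have pos: "AE x in M. w x - m > 0" by eventually_elim (simp add: A_def)
    have i0: "(\<integral>x. w x - m \<partial>M) = 0" using int by (simp add: m_def prob_space)
    have "AE x in M. w x - m = 0"
      using int pos i0 by (subst integral_nonneg_eq_0_iff_AE[symmetric]) (auto elim: eventually_mono)
    with pos have "AE x in M. False" by eventually_elim simp
    then show False by simp
  qed
  ultimately have "measure M A = 0" by simp
  then have "AE x in M. x \<notin> A"
    using A by (intro AE_not_in) (simp add: null_sets_def emeasure_eq_measure)
  then have pos: "AE x in M. 0 \<le> m - w x"
    using AE_space by eventually_elim (simp add: A_def)
  have i0: "(\<integral>x. m - w x \<partial>M) = 0" using int by (simp add: m_def prob_space)
  have "AE x in M. m - w x = 0"
    using int pos i0 by (subst integral_nonneg_eq_0_iff_AE[symmetric]) auto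
  then show ?thesis unfolding m_def by eventually_elim simp
qed

text \<open>Ergodicity speaks of strictly invariant sets. The supremum \<open>W\<close> of
  \<open>w\<close> over an orbit is strictly invariant, measurable because the group is countable,
  and equal to \<open>w\<close> almost everywhere.\<close>

lemma AE_invariant_AE_const:
  fixes w :: "'x \<Rightarrow> real"
  assumes erg: "ergodic_measure G T M" and ctbl: "countable (carrier G)"
    and w: "w \<in> borel_measurable M" "\<And>x. x \<in> space M \<Longrightarrow> \<bar>w x\<bar> \<le> B"
    and inv: "\<And>h. h \<in> carrier G \<Longrightarrow> AE x in M. w (T h x) = w x"
  shows "AE x in M. w x = (\<integral>x. w x \<partial>M)"
proof -
  define W where "W = (\<lambda>x. SUP g\<in>carrier G. w (T g x))"
  have ne: "carrier G \<noteq> {}" by auto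
  have bnd: "\<bar>w (T g x)\<bar> \<le> B" if "g \<in> carrier G" "x \<in> space M" for g x
    using w(2) action_in_space that by blast
  have bdd: "bdd_above ((\<lambda>g. w (T g x)) ` carrier G)" if "x \<in> space M" for x
    using bnd[OF _ that] by (intro bdd_aboveI2[where M = B]) (force simp: abs_le_iff)
  have Wm[measurable]: "W \<in> borel_measurable M"
    unfolding W_def using ctbl w(1) bdd
    by (intro borel_measurable_cSUP) (auto intro!: measurable_compose[OF action_measurable w(1)])
  have Wb: "\<bar>W x\<bar> \<le> B" if "x \<in> space M" for x
  proof -
    have "W x \<le> B"
      unfolding W_def using bnd[OF _ that] ne by (intro cSUP_least) (auto simp: abs_le_iff)
    moreover have "w (T \<one> x) \<le> W x"
      unfolding W_def using bdd[OF that] by (intro cSUP_upper) auto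
    ultimately show ?thesis using bnd[OF one_closed that] by linarith
  qed
  have Winv: "W (T h x) = W x" if h: "h \<in> carrier G" and x: "x \<in> space M" for h x
  proof -
    \<comment> \<open>Right multiplication by \<open>h\<close> permutes the group, so
      \<open>x\<close> and \<open>T h x\<close> yield the same set of values.\<close>
    have "(\<lambda>g. w (T g (T h x))) ` carrier G = (\<lambda>g. w (T g x)) ` (\<lambda>g. g \<otimes> h) ` carrier G"
      using composition_rule[OF x _ h] by (auto simp: image_image)
    also have "(\<lambda>g. g \<otimes> h) ` carrier G = carrier G"
    proof
      show "carrier G \<subseteq> (\<lambda>g. g \<otimes> h) ` carrier G"
      proof
        fix y assume "y \<in> carrier G"
        then have "y = (y \<otimes> inv h) \<otimes> h" "y \<otimes> inv h \<in> carrier G" using h by (simp_all add: m_assoc)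
        then show "y \<in> (\<lambda>g. g \<otimes> h) ` carrier G" by (rule image_eqI)
      qed
    qed (use h in auto)
    finally show ?thesis unfolding W_def by simp
  qed
  have "AE x in M. \<forall>g\<in>carrier G. w (T g x) = w x"
    using ctbl inv by (simp add: AE_ball_countable)
  then have eq: "AE x in M. W x = w x"
  proof eventually_elim
    case (elim x)
    then have "(\<lambda>g. w (T g x)) ` carrier G = (\<lambda>g. w x) ` carrier G" by (intro image_cong) auto
    then show ?case unfolding W_def using ne by (simp add: image_constant_conv)
  qed
  have "(\<integral>x. W x \<partial>M) = (\<integral>x. w x \<partial>M)" using eq w(1) by (intro integral_cong_AE) auto
  then show ?thesis
    using strictly_invariant_AE_const[OF erg Wm Wb Winv] eq by auto
qed

end

section \<open>Folner sequences of a measure preserving action\<close>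

locale folner_action = pmp_action +
  fixes F
  assumes folner: "folner_seq G F"
begin

lemma folner_sets: "k \<ge> 1 \<Longrightarrow> finite (F k) \<and> F k \<noteq> {} \<and> F k \<subseteq> carrier G"
  using folner unfolding folner_seq_def by blast

text \<open>Once the Folner ratio for \<open>h\<close> is below 1, \<open>F k\<close> meets its
  translate by \<open>h\<close>, so \<open>h\<close> is a quotient of two elements of
  \<open>F k\<close>. Countability allows null sets to be united over the group.\<close>

lemma countable_carrier: "countable (carrier G)"
proof -
  have "carrier G \<subseteq> (\<Union>k\<in>{1..}. \<Union>g\<in>F k. \<Union>h\<in>F k. {g \<otimes> inv h})"
  proof
    fix h assume h: "h \<in> carrier G"
    have "(\<lambda>k. real (card (sym_diff (F k) (h <#\<^bsub>G\<^esub> F k))) / card (F k)) \<longlonglongrightarrow> 0"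
      using folner h unfolding folner_seq_def by blast
    then have "\<forall>\<^sub>F k in sequentially. real (card (sym_diff (F k) (h <#\<^bsub>G\<^esub> F k))) / card (F k) < 1"
      by (rule order_tendstoD) simp
    with eventually_ge_at_top[of 1]
    have "\<forall>\<^sub>F k in sequentially. k \<ge> 1 \<and> real (card (sym_diff (F k) (h <#\<^bsub>G\<^esub> F k))) / card (F k) < 1"
      by eventually_elim simp
    then obtain k where k: "k \<ge> 1" "real (card (sym_diff (F k) (h <#\<^bsub>G\<^esub> F k))) / card (F k) < 1"
      by (auto simp: eventually_sequentially)
    have Fk: "finite (F k)" "F k \<noteq> {}" "F k \<subseteq> carrier G" using folner_sets[OF k(1)] by auto
    have "F k \<inter> (h <#\<^bsub>G\<^esub> F k) \<noteq> {}"
    proof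
      assume "F k \<inter> (h <#\<^bsub>G\<^esub> F k) = {}"
      then have "F k \<subseteq> sym_diff (F k) (h <#\<^bsub>G\<^esub> F k)" by blast
      moreover have "finite (sym_diff (F k) (h <#\<^bsub>G\<^esub> F k))"
        using Fk(1) unfolding l_coset_def by auto
      ultimately have "card (F k) \<le> card (sym_diff (F k) (h <#\<^bsub>G\<^esub> F k))" by (rule card_mono[rotated])
      then show False using k(2) Fk by (simp add: divide_less_eq card_gt_0_iff split: if_splits)
    qed
    then obtain a b where ab: "a \<in> F k" "b \<in> F k" "a = h \<otimes> b" unfolding l_coset_def by auto
    then have "h = a \<otimes> inv b" using h Fk(3) by (simp add: m_assoc subsetD)
    then show "h \<in> (\<Union>k\<in>{1..}. \<Union>g\<in>F k. \<Union>h\<in>F k. {g \<otimes> inv h})" using ab k(1) by blast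
  qed
  moreover have "countable (\<Union>k\<in>{1..}. \<Union>g\<in>F k. \<Union>h\<in>F k. {g \<otimes> inv h})"
    using folner_sets by (intro countable_UN) (auto intro: countable_finite)
  ultimately show ?thesis by (rule countable_subset)
qed

text \<open>Since \<open>T h (T g x) = T (h \<otimes> g) x\<close>, composing with
  \<open>T h\<close> replaces \<open>F k\<close> by its left translate, and the Folner condition
  makes the change negligible at every point.\<close>

lemma real_avg_translate_tendsto:
  assumes u: "\<And>x. x \<in> space M \<Longrightarrow> \<bar>u x\<bar> \<le> B" and h: "h \<in> carrier G" and x: "x \<in> space M"
  shows "(\<lambda>k. real_avg T (F k) (\<lambda>y. u (T h y)) x - real_avg T (F k) u x) \<longlonglongrightarrow> 0"
proof (rule Lim_null_comparison)
  show "(\<lambda>k. B * (real (card (sym_diff (F k) (h <#\<^bsub>G\<^esub> F k))) / card (F k))) \<longlonglongrightarrow> 0"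
    using folner h unfolding folner_seq_def by (intro tendsto_mult_right_zero) blast
  show "\<forall>\<^sub>F k in sequentially. norm (real_avg T (F k) (\<lambda>y. u (T h y)) x - real_avg T (F k) u x)
      \<le> B * (real (card (sym_diff (F k) (h <#\<^bsub>G\<^esub> F k))) / card (F k))"
    using eventually_ge_at_top[of 1]
  proof eventually_elim
    case (elim k)
    have Fk: "finite (F k)" "F k \<noteq> {}" "F k \<subseteq> carrier G" using folner_sets[OF elim] by auto
    have hF: "h <#\<^bsub>G\<^esub> F k = (\<lambda>g. h \<otimes> g) ` F k" unfolding l_coset_def by auto
    have inj: "inj_on (\<lambda>g. h \<otimes> g) (F k)"
      using inj_on_cmult[OF h] Fk(3) by (rule inj_on_subset)
    have "(\<Sum>g\<in>F k. u (T h (T g x))) = (\<Sum>g\<in>F k. u (T (h \<otimes> g) x))"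
      using composition_rule[OF x h] Fk(3) by (intro sum.cong refl) (simp add: subsetD)
    also have "\<dots> = (\<Sum>g\<in>h <#\<^bsub>G\<^esub> F k. u (T g x))"
      unfolding hF by (simp add: sum.reindex[OF inj])
    finally have "real_avg T (F k) (\<lambda>y. u (T h y)) x - real_avg T (F k) u x
        = ((\<Sum>g\<in>h <#\<^bsub>G\<^esub> F k. u (T g x)) - (\<Sum>g\<in>F k. u (T g x))) / card (F k)"
      unfolding real_avg_def by (simp add: diff_divide_distrib)
    moreover have "\<bar>(\<Sum>g\<in>h <#\<^bsub>G\<^esub> F k. u (T g x)) - (\<Sum>g\<in>F k. u (T g x))\<bar>
        \<le> B * card (sym_diff (h <#\<^bsub>G\<^esub> F k) (F k))"
      using Fk h x u action_in_space hF by (intro abs_sum_diff_le_card_sym_diff) auto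
    ultimately show ?case
      by (simp add: abs_divide divide_right_mono Un_commute)
  qed
qed

end

section \<open>The mean and pointwise ergodic theorems\<close>

context folner_action
begin

text \<open>The averages of \<open>f\<close> are traded for those of a function \<open>u\<close>
  with small first moment, to which a maximal inequality can be applied. Such \<open>u\<close> exist
  because the limit of a minimising subsequence is invariant, hence constant, and has integral
  0.\<close>

lemma mean_ergodic_L1:
  fixes f :: "'a \<Rightarrow> real"
  assumes erg: "ergodic_measure G T M"
    and f: "f \<in> borel_measurable M" "\<And>x. x \<in> space M \<Longrightarrow> \<bar>f x\<bar> \<le> B" "(\<integral>x. f x \<partial>M) = 0"
    and e: "e > 0"
  shows "\<exists>u. u \<in> borel_measurable M \<and> (\<forall>x\<in>space M. \<bar>u x\<bar> \<le> B) \<and>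
           (\<forall>x\<in>space M. (\<lambda>k. real_avg T (F k) u x - real_avg T (F k) f x) \<longlonglongrightarrow> 0) \<and>
           (\<integral>x. \<bar>u x\<bar> \<partial>M) < e"
proof -
  \<comment> \<open>\<open>S\<close> is closed under midpoints and translations, so by the parallelogram law any sequence
     minimising the second moment over \<open>S\<close> is Cauchy and asymptotically invariant.\<close>
  define S where "S = {u. u \<in> borel_measurable M \<and> (\<forall>x\<in>space M. \<bar>u x\<bar> \<le> B) \<and> (\<integral>x. u x \<partial>M) = 0 \<and>
           (\<forall>x\<in>space M. (\<lambda>k. real_avg T (F k) u x - real_avg T (F k) f x) \<longlonglongrightarrow> 0)}"
  have Sm: "u \<in> borel_measurable M" and Sb: "x \<in> space M \<Longrightarrow> \<bar>u x\<bar> \<le> B"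
    and S0: "(\<integral>x. u x \<partial>M) = 0"
    and Slim: "x \<in> space M \<Longrightarrow> (\<lambda>k. real_avg T (F k) u x - real_avg T (F k) f x) \<longlonglongrightarrow> 0"
    if "u \<in> S" for u x
    using that unfolding S_def by auto
  have Si: "integrable M u" if "u \<in> S" for u
    using Sm[OF that] Sb[OF that] by (rule integrable_bounded)
  have Si2: "integrable M (\<lambda>x. u x * v x)" if "u \<in> S" "v \<in> S" for u v
    using Sm[OF that(1)] Sm[OF that(2)] Sb[OF that(1)] Sb[OF that(2)]
    by (intro integrable_bounded[where B = "B * B"]) (auto simp: abs_mult intro!: mult_mono order_trans[OF abs_ge_zero])
  have fS: "f \<in> S" unfolding S_def using f by simp
  have midS: "(\<lambda>x. (u x + v x) / 2) \<in> S" if u: "u \<in> S" and v: "v \<in> S" for u v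
  proof -
    have "(\<lambda>k. real_avg T (F k) (\<lambda>x. (u x + v x) / 2) x - real_avg T (F k) f x) \<longlonglongrightarrow> 0" if "x \<in> space M" for x
    proof -
      have "(\<lambda>k. ((real_avg T (F k) u x - real_avg T (F k) f x) + (real_avg T (F k) v x - real_avg T (F k) f x)) / 2) \<longlonglongrightarrow> (0 + 0) / 2"
        using Slim[OF u that] Slim[OF v that] by (intro tendsto_intros) auto
      moreover have "((real_avg T K u x - real_avg T K f x) + (real_avg T K v x - real_avg T K f x)) / 2
          = real_avg T K (\<lambda>x. (u x + v x) / 2) x - real_avg T K f x" for K
        unfolding real_avg_def by (simp add: sum_divide_distrib[symmetric] sum.distrib add_divide_distrib diff_divide_distrib)
      ultimately show ?thesis by (simp only: add_0_left div_0)
    qed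
    moreover have "\<bar>(u x + v x) / 2\<bar> \<le> B" if "x \<in> space M" for x
      using Sb[OF u that] Sb[OF v that] by (simp add: abs_le_iff)
    ultimately show ?thesis
      using Sm[OF u] Sm[OF v] Si[OF u] Si[OF v] S0[OF u] S0[OF v] unfolding S_def by simp
  qed
  have transS: "(\<lambda>x. u (T h x)) \<in> S" if u: "u \<in> S" and h: "h \<in> carrier G" for u h
  proof -
    have "(\<lambda>k. real_avg T (F k) (\<lambda>x. u (T h x)) x - real_avg T (F k) f x) \<longlonglongrightarrow> 0" if "x \<in> space M" for x
      using tendsto_add[OF real_avg_translate_tendsto[where u = u, OF Sb[OF u] h that] Slim[OF u that]]
      by simp
    moreover have "(\<lambda>x. u (T h x)) \<in> borel_measurable M"
      using action_measurable[OF h] Sm[OF u] by measurable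
    ultimately show ?thesis
      using Sb[OF u] S0[OF u] integral_action[OF h Sm[OF u]] action_in_space[OF h] unfolding S_def by auto
  qed
  define c where "c = (INF u\<in>S. \<integral>x. u x * u x \<partial>M)"
  have bdd: "bdd_below ((\<lambda>u. \<integral>x. u x * u x \<partial>M) ` S)"
    by (intro bdd_belowI2[where m = 0] integral_nonneg) auto
  have c_le: "c \<le> (\<integral>x. u x * u x \<partial>M)" if "u \<in> S" for u
    unfolding c_def using bdd that by (rule cINF_lower)
  have near: "(\<integral>x. \<bar>u x - v x\<bar> \<partial>M) \<le> 3 * d"
    if u: "u \<in> S" "(\<integral>x. u x * u x \<partial>M) < c + d\<^sup>2" and v: "v \<in> S" "(\<integral>x. v x * v x \<partial>M) < c + d\<^sup>2"
      and d: "d > 0" for u v d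
  proof -
    note ints = Si[OF u(1)] Si[OF v(1)] Si2[OF u(1) u(1)] Si2[OF v(1) v(1)] Si2[OF u(1) v(1)]
    have "c \<le> (\<integral>x. (u x + v x) / 2 * ((u x + v x) / 2) \<partial>M)"
      using c_le[OF midS[OF u(1) v(1)]] .
    also have "\<dots> = (\<integral>x. (u x * u x) / 4 + (v x * v x) / 4 + (u x * v x) / 2 \<partial>M)"
      by (intro Bochner_Integration.integral_cong refl) (simp add: field_simps)
    also have "\<dots> = (\<integral>x. u x * u x \<partial>M) / 4 + (\<integral>x. v x * v x \<partial>M) / 4 + (\<integral>x. u x * v x \<partial>M) / 2"
      using ints by simp
    finally have cross: "4 * c \<le> (\<integral>x. u x * u x \<partial>M) + (\<integral>x. v x * v x \<partial>M) + 2 * (\<integral>x. u x * v x \<partial>M)"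
      by simp
    \<comment> \<open>That the square of \<open>\<bar>u x - v x\<bar> - d\<close> is nonnegative
      bounds the first moment of the difference by its second moment over \<open>2 * d\<close>, plus
      \<open>d / 2\<close>. By \<open>cross\<close> the second moment is below
      \<open>4 * d\<^sup>2\<close>, which gives \<open>5 / 2 * d\<close>.\<close>
    have "(\<integral>x. \<bar>u x - v x\<bar> \<partial>M) \<le> (\<integral>x. ((u x * u x) + (v x * v x) - 2 * (u x * v x)) / (2 * d) + d / 2 \<partial>M)"
    proof (rule integral_mono)
      fix x
      have "0 \<le> (\<bar>u x - v x\<bar> - d)\<^sup>2" by simp
      also have "\<dots> = (u x * u x) + (v x * v x) - 2 * (u x * v x) + d * d - 2 * d * \<bar>u x - v x\<bar>"
        unfolding power2_diff power2_abs by (simp add: power2_eq_square algebra_simps)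
      finally show "\<bar>u x - v x\<bar> \<le> ((u x * u x) + (v x * v x) - 2 * (u x * v x)) / (2 * d) + d / 2"
        using d by (simp add: field_simps)
    qed (use ints in auto)
    also have "\<dots> = ((\<integral>x. u x * u x \<partial>M) + (\<integral>x. v x * v x \<partial>M) - 2 * (\<integral>x. u x * v x \<partial>M)) / (2 * d) + d / 2"
      using ints by (simp add: prob_space)
    also have "\<dots> \<le> (4 * d\<^sup>2) / (2 * d) + d / 2"
      using cross u(2) v(2) d by (intro add_right_mono divide_right_mono) auto
    also have "\<dots> \<le> 3 * d" using d by (simp add: power2_eq_square)
    finally show ?thesis .
  qed
  \<comment> \<open>The slack is a square so that \<open>near\<close> turns it into an L1 distance
    of at most \<open>3 * (1 / real (Suc i))\<close>.\<close>
  have "\<exists>s. s \<in> S \<and> (\<integral>x. s x * s x \<partial>M) < c + (1 / real (Suc i))\<^sup>2" for i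
  proof -
    have "c < c + (1 / real (Suc i))\<^sup>2" by simp
    moreover have "c < y \<longleftrightarrow> (\<exists>s\<in>S. (\<integral>x. s x * s x \<partial>M) < y)" for y
      unfolding c_def using fS bdd by (intro cINF_less_iff) auto
    ultimately show ?thesis by blast
  qed
  then obtain s where sS: "\<And>i. s i \<in> S" and s: "\<And>i. (\<integral>x. s i x * s i x \<partial>M) < c + (1 / real (Suc i))\<^sup>2"
    by metis
  have s_near: "(\<integral>x. s i x * s i x \<partial>M) < c + (1 / real (Suc N))\<^sup>2" if "i \<ge> N" for i N
  proof -
    have "(1 / real (Suc i))\<^sup>2 \<le> (1 / real (Suc N))\<^sup>2"
      using that by (intro power_mono divide_left_mono) auto
    then show ?thesis using s[of i] by linarith
  qed
  have lim3: "(\<lambda>N. 3 * (1 / real (Suc N))) \<longlonglongrightarrow> 0"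
    using LIMSEQ_inverse_real_of_nat by (intro tendsto_mult_right_zero) (simp add: divide_inverse)
  have "\<exists>N. \<forall>i\<ge>N. \<forall>j\<ge>N. (\<integral>x. norm (s i x - s j x) \<partial>M) < \<epsilon>" if "\<epsilon> > 0" for \<epsilon>
  proof -
    obtain N where N: "3 * (1 / real (Suc N)) < \<epsilon>"
      using order_tendstoD(2)[OF lim3 \<open>\<epsilon> > 0\<close>] by (auto simp: eventually_sequentially)
    have "(\<integral>x. norm (s i x - s j x) \<partial>M) < \<epsilon>" if "i \<ge> N" "j \<ge> N" for i j
      using near[OF sS s_near[OF that(1)] sS s_near[OF that(2)]] N by simp
    then show ?thesis by blast
  qed
  then obtain r where r: "strict_mono r" and cau: "AE x in M. Cauchy (\<lambda>i. s (r i) x)"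
    using cauchy_L1_AE_cauchy_subseq[of M s, OF Si[OF sS]] by metis
  define t where "t = (\<lambda>i. s (r i))"
  \<comment> \<open>Clamping makes \<open>u\<close> bounded by \<open>B\<close> everywhere, also
    where the limit does not exist and \<open>lim\<close> is arbitrary; on \<open>space M\<close> an
    existing limit is unchanged.\<close>
  define u where "u = (\<lambda>x. max (- B) (min B (lim (\<lambda>i. t i x))))"
  have tS: "t i \<in> S" for i unfolding t_def by (rule sS)
  have tm[measurable]: "t i \<in> borel_measurable M" for i using Sm[OF tS] .
  have um[measurable]: "u \<in> borel_measurable M" unfolding u_def by measurable
  have "B \<ge> 0" using f(2) not_empty by (meson abs_ge_zero all_not_in_conv order_trans)
  then have ub: "\<bar>u x\<bar> \<le> B" for x unfolding u_def by auto
  have t_lim: "AE x in M. (\<lambda>i. t i x) \<longlonglongrightarrow> u x"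
    using cau AE_space
  proof eventually_elim
    case (elim x)
    then have "(\<lambda>i. t i x) \<longlonglongrightarrow> lim (\<lambda>i. t i x)"
      unfolding t_def using Cauchy_convergent_iff convergent_LIMSEQ_iff by blast
    then have "(\<lambda>i. max (- B) (min B (t i x))) \<longlonglongrightarrow> u x"
      unfolding u_def by (intro tendsto_intros)
    moreover have "max (- B) (min B (t i x)) = t i x" for i
      using Sb[OF tS elim(2), of i] by auto
    ultimately show ?case by simp
  qed
  have u_inv: "AE x in M. u (T h x) = u x" if h: "h \<in> carrier G" for h
  proof -
    have [measurable]: "T h \<in> measurable M M" using h by (rule action_measurable)
    have "(\<lambda>i. \<integral>x. \<bar>t i (T h x) - t i x\<bar> \<partial>M) \<longlonglongrightarrow> 0"
    proof (rule Lim_null_comparison)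
      show "(\<lambda>i. 3 * (1 / real (Suc i))) \<longlonglongrightarrow> 0" by (rule lim3)
      have "(\<integral>x. \<bar>t i (T h x) - t i x\<bar> \<partial>M) \<le> 3 * (1 / real (Suc i))" for i
      proof (rule near)
        have *: "(\<integral>x. t i x * t i x \<partial>M) < c + (1 / real (Suc i))\<^sup>2"
          unfolding t_def using strict_mono_imp_increasing[OF r] by (rule s_near)
        then show "(\<integral>x. t i x * t i x \<partial>M) < c + (1 / real (Suc i))\<^sup>2" .
        \<comment> \<open>The translate has the same second moment as \<open>t i\<close> because
          \<open>T h\<close> preserves the measure, so both are near-minimisers and
          \<open>near\<close> makes them close.\<close>
        show "(\<integral>x. t i (T h x) * t i (T h x) \<partial>M) < c + (1 / real (Suc i))\<^sup>2"
          using * by (subst integral_action[OF h, of "\<lambda>x. t i x * t i x"]) auto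
      qed (use tS transS[OF tS h] in auto)
      then show "\<forall>\<^sub>F i in sequentially. norm (\<integral>x. \<bar>t i (T h x) - t i x\<bar> \<partial>M) \<le> 3 * (1 / real (Suc i))"
        by (simp add: integral_nonneg_AE)
    qed
    moreover have "(\<lambda>i. \<integral>x. \<bar>t i (T h x) - t i x\<bar> \<partial>M) \<longlonglongrightarrow> (\<integral>x. \<bar>u (T h x) - u x\<bar> \<partial>M)"
    proof (rule integral_dominated_convergence[where w = "\<lambda>_. 2 * B"])
      show "AE x in M. (\<lambda>i. \<bar>t i (T h x) - t i x\<bar>) \<longlonglongrightarrow> \<bar>u (T h x) - u x\<bar>"
        using t_lim AE_action[OF h t_lim] by eventually_elim (intro tendsto_intros)
      show "AE x in M. norm \<bar>t i (T h x) - t i x\<bar> \<le> 2 * B" for i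
      proof (rule AE_I2)
        fix x assume x: "x \<in> space M"
        show "norm \<bar>t i (T h x) - t i x\<bar> \<le> 2 * B"
          using Sb[OF tS x, of i] Sb[OF tS action_in_space[OF h x], of i] by simp
      qed
    qed auto
    ultimately have "(\<integral>x. \<bar>u (T h x) - u x\<bar> \<partial>M) = 0" by (rule LIMSEQ_unique[rotated])
    moreover have "integrable M (\<lambda>x. \<bar>u (T h x) - u x\<bar>)"
    proof (rule integrable_bounded)
      show "\<bar>\<bar>u (T h x) - u x\<bar>\<bar> \<le> 2 * B" for x
        using ub[of "T h x"] ub[of x] by linarith
    qed measurable
    ultimately have "AE x in M. \<bar>u (T h x) - u x\<bar> = 0"
      by (subst (asm) integral_nonneg_eq_0_iff_AE) auto
    then show ?thesis by eventually_elim simp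
  qed
  have const: "AE x in M. u x = (\<integral>x. u x \<partial>M)"
    using erg countable_carrier um ub u_inv by (rule AE_invariant_AE_const)
  have bnd: "AE x in M. norm (t i x) \<le> B" for i using Sb[OF tS] by (intro AE_I2) simp
  have "(\<lambda>i. \<integral>x. t i x \<partial>M) \<longlonglongrightarrow> (\<integral>x. u x \<partial>M)"
    using t_lim bnd by (intro integral_dominated_convergence[where w = "\<lambda>_. B"]) auto
  then have "(\<integral>x. u x \<partial>M) = 0" using S0[OF tS] by (simp add: LIMSEQ_const_iff)
  then have u0: "AE x in M. u x = 0" using const by simp
  have "(\<lambda>i. \<integral>x. \<bar>t i x\<bar> \<partial>M) \<longlonglongrightarrow> (\<integral>x. 0 \<partial>M)"
  proof (rule integral_dominated_convergence[where w = "\<lambda>_. B"])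
    show "AE x in M. (\<lambda>i. \<bar>t i x\<bar>) \<longlonglongrightarrow> 0"
      using t_lim u0
    proof eventually_elim
      case (elim x)
      then show ?case using tendsto_rabs[OF elim(1)] by simp
    qed
  qed (use bnd in auto)
  then have "\<forall>\<^sub>F i in sequentially. (\<integral>x. \<bar>t i x\<bar> \<partial>M) < e"
    using e by (intro order_tendstoD(2)) auto
  then obtain i where "(\<integral>x. \<bar>t i x\<bar> \<partial>M) < e" by (auto simp: eventually_sequentially)
  then show ?thesis using Sm[OF tS] Sb[OF tS] Slim[OF tS] by blast
qed

text \<open>Transference to orbits: the inequality on the group, applied to the times
  \<open>a \<in> F k\<close> at which the orbit of \<open>x\<close> visits \<open>E\<close>, is
  integrated over \<open>x\<close>. Invariance gives \<open>card (F k)\<close> copies of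
  \<open>measure M E\<close> against \<open>card (P <#> F k)\<close> copies of the integral, and the
  ratio of these cardinalities is bounded by a sequence tending to 1. The cutoff \<open>N\<close>
  keeps \<open>P\<close> finite.\<close>

lemma transferred_maximal_inequality:
  fixes e :: "'a \<Rightarrow> real" and c l :: real
  assumes temp: "\<And>k. k \<ge> 2 \<Longrightarrow> card (\<Union>j\<in>{1..k-1}. (set_inv (F j)) <#> F k) \<le> c * card (F k)"
    and c: "c \<ge> 0" and l: "l \<ge> 0"
    and e: "e \<in> borel_measurable M" "\<And>x. x \<in> space M \<Longrightarrow> 0 \<le> e x" "integrable M e"
  shows "l * measure M {x \<in> space M. \<exists>n\<in>{1..N}. l < real_avg T (F n) e x} \<le> 2 * (1 + c) * (\<integral>x. e x \<partial>M)"
proof -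
  define E where "E = {x \<in> space M. \<exists>n\<in>{1..N}. l < real_avg T (F n) e x}"
  define P where "P = (\<Union>n\<in>{1..N}. F n)"
  have "finite (F n) \<and> F n \<subseteq> carrier G" if "n \<in> {1..N}" for n
    using folner_sets[of n] that by simp
  then have finP: "finite P" and Pc: "P \<subseteq> carrier G"
    unfolding P_def by blast+
  have [measurable]: "E \<in> sets M"
  proof -
    have "{x \<in> space M. l < real_avg T (F n) e x} \<in> sets M" if "n \<in> {1..N}" for n
    proof -
      have [measurable]: "real_avg T (F n) e \<in> borel_measurable M"
        using that folner_sets e(1) by (intro real_avg_measurable) auto
      show ?thesis by measurable
    qed
    then have "(\<Union>n\<in>{1..N}. {x \<in> space M. l < real_avg T (F n) e x}) \<in> sets M" by blast
    also have "(\<Union>n\<in>{1..N}. {x \<in> space M. l < real_avg T (F n) e x}) = E" unfolding E_def by blast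
    finally show ?thesis .
  qed
  have ratio: "l * measure M E * card (F k) \<le> 2 * (1 + c) * (\<integral>x. e x \<partial>M) * card (P <#> F k)" if k: "k \<ge> 1" for k
  proof -
    let ?K = "F k" and ?Q = "P <#> F k"
    have K: "finite ?K" "?K \<noteq> {}" "?K \<subseteq> carrier G" using folner_sets[OF k] by auto
    have Q: "finite ?Q" "?Q \<subseteq> carrier G"
      using finP Pc K unfolding set_mult_def by auto
    have pw: "l * (\<Sum>a\<in>?K. indicator E (T a x)) \<le> 2 * (1 + c) * (\<Sum>g\<in>?Q. e (T g x))"
      if x: "x \<in> space M" for x
    proof -
      define D where "D = {a \<in> ?K. T a x \<in> E}"
      have "\<forall>a\<in>D. \<exists>n. n \<in> {1..N} \<and> l < real_avg T (F n) e (T a x)"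
        unfolding D_def E_def by auto
      \<comment> \<open>\<open>m a\<close> witnesses \<open>T a x \<in> E\<close>. As
        \<open>m a \<le> N\<close> and \<open>a \<in> F k\<close>, the translate of
        \<open>F (m a)\<close> by \<open>a\<close> stays inside \<open>P <#> F k\<close>, the finite
        window for the inequality on the group.\<close>
      then obtain m where m: "\<And>a. a \<in> D \<Longrightarrow> m a \<in> {1..N}"
        "\<And>a. a \<in> D \<Longrightarrow> l < real_avg T (F (m a)) e (T a x)"
        by metis
      have "l * card D \<le> 2 * (1 + c) * sum (\<lambda>g. e (T g x)) ?Q"
      proof (rule discrete_maximal_inequality[where F = F and m = m])
        show "F (m a) #> a \<subseteq> ?Q" if "a \<in> D" for a
          using m(1)[OF that] that unfolding D_def P_def r_coset_def set_mult_def by blast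
        show "l * card (F (m a)) \<le> (\<Sum>g\<in>F (m a). e (T (g \<otimes> a) x))" if a: "a \<in> D" for a
        proof -
          have Fm: "finite (F (m a))" "F (m a) \<noteq> {}" "F (m a) \<subseteq> carrier G" and ac: "a \<in> carrier G"
            using folner_sets[of "m a"] m(1)[OF a] a K unfolding D_def by auto
          then have "card (F (m a)) > 0" by (simp add: card_gt_0_iff)
          then have "l * card (F (m a)) < (\<Sum>g\<in>F (m a). e (T g (T a x)))"
            using m(2)[OF a] unfolding real_avg_def by (simp add: less_divide_eq)
          also have "\<dots> = (\<Sum>g\<in>F (m a). e (T (g \<otimes> a) x))"
            using composition_rule[OF x _ ac] Fm(3) by (intro sum.cong refl) (simp add: subsetD)
          finally show ?thesis by simp
        qed
        show "D \<subseteq> carrier G" using K unfolding D_def by auto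
        show "0 \<le> e (T g x)" if "g \<in> ?Q" for g
          using e(2) action_in_space[OF _ x] Q(2) that by blast
        show "finite D" using K unfolding D_def by simp
        show "1 \<le> m a" if "a \<in> D" for a using m(1)[OF that] by simp
      qed (use folner_sets temp c l Q in auto)
      moreover have "(\<Sum>a\<in>?K. indicator E (T a x)) = real (card D)"
        using K(1) unfolding D_def indicator_def by (simp add: sum.If_cases Int_def)
      ultimately show ?thesis by simp
    qed
    have intE: "integrable M (\<lambda>x. indicator E (T a x) :: real)" if "a \<in> ?K" for a
    proof (rule integrable_action)
      show "integrable M (indicator E :: _ \<Rightarrow> real)"
        by (intro integrable_bounded[where B = 1]) (auto simp: indicator_def)
    qed (use that K in auto)
    have inte: "integrable M (\<lambda>x. e (T g x))" if "g \<in> ?Q" for g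
      using that Q e by (intro integrable_action) auto
    have "l * (\<Sum>a\<in>?K. (\<integral>x. indicator E (T a x) \<partial>M)) = (\<integral>x. l * (\<Sum>a\<in>?K. indicator E (T a x)) \<partial>M)"
      using intE by simp
    also have "\<dots> \<le> (\<integral>x. 2 * (1 + c) * (\<Sum>g\<in>?Q. e (T g x)) \<partial>M)"
      using intE inte pw by (intro integral_mono) auto
    also have "\<dots> = 2 * (1 + c) * (\<Sum>g\<in>?Q. (\<integral>x. e (T g x) \<partial>M))"
      using inte by simp
    also have "(\<Sum>g\<in>?Q. (\<integral>x. e (T g x) \<partial>M)) = (\<Sum>g\<in>?Q. (\<integral>x. e x \<partial>M))"
      using Q e by (intro sum.cong refl integral_action) auto
    also have "(\<Sum>a\<in>?K. (\<integral>x. indicator E (T a x) \<partial>M)) = (\<Sum>a\<in>?K. measure M E)"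
    proof (rule sum.cong[OF refl])
      fix a assume "a \<in> ?K"
      then show "(\<integral>x. indicator E (T a x) \<partial>M) = measure M E"
        using K integral_action[of a "indicator E :: _ \<Rightarrow> real"] by auto
    qed
    finally show ?thesis by (simp add: algebra_simps)
  qed
  \<comment> \<open>Each translate of \<open>F k\<close> by some \<open>p \<in> P\<close> adds to
    \<open>F k\<close> at most their symmetric difference, so for \<open>k \<ge> 1\<close> the value
    \<open>q k\<close> bounds \<open>card (P <#> F k) / card (F k)\<close>.\<close>
  define q where "q = (\<lambda>k. 1 + (\<Sum>p\<in>P. real (card (sym_diff (F k) (p <#\<^bsub>G\<^esub> F k))) / card (F k)))"
  have q_lim: "q \<longlonglongrightarrow> 1 + (\<Sum>p\<in>P. 0)"
    unfolding q_def using folner Pc unfolding folner_seq_def by (intro tendsto_add tendsto_const tendsto_sum) auto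
  have "l * measure M E \<le> 2 * (1 + c) * (\<integral>x. e x \<partial>M) * q k" if k: "k \<ge> 1" for k
  proof -
    have K: "finite (F k)" "F k \<noteq> {}" "F k \<subseteq> carrier G" using folner_sets[OF k] by auto
    then have pos: "card (F k) > 0" by (simp add: card_gt_0_iff)
    have finD: "finite (\<Union>p\<in>P. sym_diff (F k) (p <#\<^bsub>G\<^esub> F k))"
      using finP K(1) unfolding l_coset_def by auto
    have "P <#> F k \<subseteq> F k \<union> (\<Union>p\<in>P. sym_diff (F k) (p <#\<^bsub>G\<^esub> F k))"
      unfolding set_mult_def l_coset_def by blast
    then have "card (P <#> F k) \<le> card (F k \<union> (\<Union>p\<in>P. sym_diff (F k) (p <#\<^bsub>G\<^esub> F k)))"
      using K(1) finD by (intro card_mono) auto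
    also have "\<dots> \<le> card (F k) + card (\<Union>p\<in>P. sym_diff (F k) (p <#\<^bsub>G\<^esub> F k))" by (rule card_Un_le)
    also have "\<dots> \<le> card (F k) + (\<Sum>p\<in>P. card (sym_diff (F k) (p <#\<^bsub>G\<^esub> F k)))"
      using finP by (intro add_left_mono card_UN_le)
    finally have "real (card (P <#> F k)) \<le> card (F k) + (\<Sum>p\<in>P. card (sym_diff (F k) (p <#\<^bsub>G\<^esub> F k)))"
      by (simp only: of_nat_le_iff)
    also have "\<dots> = q k * card (F k)"
      unfolding q_def using pos by (simp add: distrib_right sum_distrib_right)
    finally have "card (P <#> F k) \<le> q k * card (F k)" .
    then have "2 * (1 + c) * (\<integral>x. e x \<partial>M) * card (P <#> F k)
        \<le> 2 * (1 + c) * (\<integral>x. e x \<partial>M) * (q k * card (F k))"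
      using c e(2) by (intro mult_left_mono mult_nonneg_nonneg integral_nonneg_AE AE_I2) auto
    with ratio[OF k] have "l * measure M E * card (F k) \<le> (2 * (1 + c) * (\<integral>x. e x \<partial>M) * q k) * card (F k)"
      by (simp add: mult.assoc)
    then show ?thesis using pos by simp
  qed
  then have "l * measure M E \<le> 2 * (1 + c) * (\<integral>x. e x \<partial>M) * (1 + (\<Sum>p\<in>P. 0))"
    by (intro LIMSEQ_le_const[OF tendsto_mult_left[OF q_lim]]) blast
  then show ?thesis unfolding E_def by simp
qed

text \<open>The truncated bound is uniform in \<open>N\<close>, so continuity of the measure from
  below removes the cutoff.\<close>

lemma weak_type_maximal_inequality:
  fixes e :: "'a \<Rightarrow> real" and c l :: real
  assumes temp: "\<And>k. k \<ge> 2 \<Longrightarrow> card (\<Union>j\<in>{1..k-1}. (set_inv (F j)) <#> F k) \<le> c * card (F k)"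
    and c: "c \<ge> 0" and l: "l \<ge> 0"
    and e: "e \<in> borel_measurable M" "\<And>x. x \<in> space M \<Longrightarrow> 0 \<le> e x" "integrable M e"
  shows "{x \<in> space M. \<exists>n\<ge>1. l < real_avg T (F n) e x} \<in> sets M"
    and "l * measure M {x \<in> space M. \<exists>n\<ge>1. l < real_avg T (F n) e x} \<le> 2 * (1 + c) * (\<integral>x. e x \<partial>M)"
proof -
  let ?E = "\<lambda>N. {x \<in> space M. \<exists>n\<in>{1..N}. l < real_avg T (F n) e x}"
  have avg[measurable]: "real_avg T (F n) e \<in> borel_measurable M" if "n \<ge> 1" for n
    using that folner_sets e(1) by (intro real_avg_measurable) auto
  have Em: "?E N \<in> sets M" for N
  proof -
    have "(\<Union>n\<in>{1..N}. {x \<in> space M. l < real_avg T (F n) e x}) \<in> sets M" using avg by auto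
    also have "(\<Union>n\<in>{1..N}. {x \<in> space M. l < real_avg T (F n) e x}) = ?E N" by blast
    finally show ?thesis .
  qed
  have Un: "(\<Union>N. ?E N) = {x \<in> space M. \<exists>n\<ge>1. l < real_avg T (F n) e x}" by fastforce
  show "{x \<in> space M. \<exists>n\<ge>1. l < real_avg T (F n) e x} \<in> sets M"
    unfolding Un[symmetric] using Em by blast
  have "incseq ?E" by (intro incseq_SucI) auto
  then have "(\<lambda>N. measure M (?E N)) \<longlonglongrightarrow> measure M (\<Union>N. ?E N)"
    using Em by (intro finite_Lim_measure_incseq) auto
  then have "(\<lambda>N. l * measure M (?E N)) \<longlonglongrightarrow> l * measure M {x \<in> space M. \<exists>n\<ge>1. l < real_avg T (F n) e x}"
    unfolding Un by (rule tendsto_mult_left)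
  then show "l * measure M {x \<in> space M. \<exists>n\<ge>1. l < real_avg T (F n) e x} \<le> 2 * (1 + c) * (\<integral>x. e x \<partial>M)"
    using transferred_maximal_inequality[OF temp c l e] by (intro LIMSEQ_le_const2) auto
qed

text \<open>Where the averages of \<open>f\<close> exceed \<open>2 * l\<close> in absolute value
  infinitely often, those of \<open>\<bar>u x\<bar>\<close> exceed \<open>l\<close> at least once,
  so the bad set has measure at most any given \<open>\<epsilon>\<close>.\<close>

lemma AE_real_avg_tendsto_0:
  fixes f :: "'a \<Rightarrow> real"
  assumes temp: "tempered_seq G F" and erg: "ergodic_measure G T M"
    and f: "f \<in> borel_measurable M" "\<And>x. x \<in> space M \<Longrightarrow> \<bar>f x\<bar> \<le> B" "(\<integral>x. f x \<partial>M) = 0"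
  shows "AE x in M. (\<lambda>k. real_avg T (F k) f x) \<longlonglongrightarrow> 0"
proof -
  obtain c where c: "c > 0"
    and tc: "\<And>k. k \<ge> 2 \<Longrightarrow> real (card (\<Union>j\<in>{1..k-1}. (set_inv (F j)) <#> F k)) \<le> c * real (card (F k))"
    using temp unfolding tempered_seq_def by auto
  have avg[measurable]: "real_avg T (F (Suc n)) f \<in> borel_measurable M" for n
    using folner_sets[of "Suc n"] f(1) by (intro real_avg_measurable) auto
  \<comment> \<open>\<open>Suc k\<close> skips the unconstrained set \<open>F 0\<close>. The
    threshold \<open>2 * l\<close> leaves \<open>l\<close> for the difference between the averages
    of \<open>f\<close> and \<open>u\<close>, and \<open>l\<close> for the maximal
    inequality.\<close>
  define Bad where "Bad = (\<lambda>l. {x \<in> space M. \<forall>N. \<exists>k\<ge>N. 2 * l < \<bar>real_avg T (F (Suc k)) f x\<bar>})"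
  have Bad_m: "Bad l \<in> sets M" for l
    unfolding Bad_def by measurable
  have "measure M (Bad l) = 0" if l: "l > 0" for l
  proof -
    have "measure M (Bad l) \<le> 0 + \<epsilon>" if \<epsilon>: "\<epsilon> > 0" for \<epsilon>
    proof -
      \<comment> \<open>Chosen so that the constant \<open>2 * (1 + c)\<close> of the maximal
        inequality and the level \<open>l\<close> cancel, leaving \<open>\<epsilon>\<close>.\<close>
      have "l * \<epsilon> / (2 * (1 + c)) > 0" using l \<epsilon> c by simp
      \<comment> \<open>\<open>f\<close> and \<open>u\<close> have asymptotically equal averages, and the maximal inequality is applied to \<open>u\<close>.\<close>
      from mean_ergodic_L1[OF erg f this]
      obtain u where u: "u \<in> borel_measurable M" "\<And>x. x \<in> space M \<Longrightarrow> \<bar>u x\<bar> \<le> B"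
        "\<And>x. x \<in> space M \<Longrightarrow> (\<lambda>k. real_avg T (F k) u x - real_avg T (F k) f x) \<longlonglongrightarrow> 0"
        "(\<integral>x. \<bar>u x\<bar> \<partial>M) < l * \<epsilon> / (2 * (1 + c))"
        by blast
      note u(1)[measurable]
      let ?Z = "{x \<in> space M. \<exists>n\<ge>1. l < real_avg T (F n) (\<lambda>x. \<bar>u x\<bar>) x}"
      have iu: "integrable M (\<lambda>x. \<bar>u x\<bar>)"
        using integrable_bounded[OF u(1,2)] by simp
      have l0: "l \<ge> 0" and c0: "c \<ge> 0" using l c by auto
      have um: "(\<lambda>x. \<bar>u x\<bar>) \<in> borel_measurable M" by measurable
      have Zm: "?Z \<in> sets M" and "l * measure M ?Z \<le> 2 * (1 + c) * (\<integral>x. \<bar>u x\<bar> \<partial>M)"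
        using weak_type_maximal_inequality[OF tc c0 l0 um abs_ge_zero iu] by blast+
      note this(2)
      also have "2 * (1 + c) * (\<integral>x. \<bar>u x\<bar> \<partial>M) \<le> l * \<epsilon>"
        using u(4) c by (simp add: field_simps)
      finally have "measure M ?Z \<le> \<epsilon>" using l by simp
      moreover have "Bad l \<subseteq> ?Z"
      proof
        fix x assume x: "x \<in> Bad l"
        then have xs: "x \<in> space M" unfolding Bad_def by simp
        have "\<forall>\<^sub>F k in sequentially. dist (real_avg T (F k) u x - real_avg T (F k) f x) 0 < l"
          using u(3)[OF xs] l by (rule tendstoD)
        then obtain N where N: "\<And>k. k \<ge> N \<Longrightarrow> \<bar>real_avg T (F k) u x - real_avg T (F k) f x\<bar> < l"
          by (auto simp: eventually_sequentially)
        obtain k where k: "k \<ge> N" "2 * l < \<bar>real_avg T (F (Suc k)) f x\<bar>"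
          using x unfolding Bad_def by blast
        have "l < \<bar>real_avg T (F (Suc k)) u x\<bar>" using N[of "Suc k"] k by linarith
        also have "\<dots> \<le> real_avg T (F (Suc k)) (\<lambda>x. \<bar>u x\<bar>) x"
          unfolding real_avg_def by (simp add: abs_divide divide_right_mono sum_abs)
        finally show "x \<in> ?Z" using xs by auto
      qed
      then have "measure M (Bad l) \<le> measure M ?Z" using Zm by (rule finite_measure_mono)
      ultimately show ?thesis by linarith
    qed
    then have "measure M (Bad l) \<le> 0" by (rule field_le_epsilon)
    then show ?thesis by (simp add: measure_le_0_iff)
  qed
  then have "AE x in M. x \<notin> Bad (1 / real (Suc j))" for j
    using Bad_m by (intro AE_not_in) (simp add: null_sets_def emeasure_eq_measure)
  then have "AE x in M. \<forall>j. x \<notin> Bad (1 / real (Suc j))" by (simp add: AE_all_countable)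
  then show ?thesis
    using AE_space
  proof eventually_elim
    case (elim x)
    have "(\<lambda>k. real_avg T (F (Suc k)) f x) \<longlonglongrightarrow> 0"
    proof (rule LIMSEQ_I)
      fix r :: real assume "r > 0"
      then obtain j where "1 / real (Suc j) < r / 2" using nat_approx_posE[of "r / 2"] by auto
      moreover obtain N where "\<And>k. k \<ge> N \<Longrightarrow> \<not> 2 * (1 / real (Suc j)) < \<bar>real_avg T (F (Suc k)) f x\<bar>"
        using elim unfolding Bad_def by blast
      ultimately show "\<exists>N. \<forall>k\<ge>N. norm (real_avg T (F (Suc k)) f x - 0) < r"
        by (intro exI[of _ N]) force
    qed
    then show ?case by (rule LIMSEQ_imp_Suc)
  qed
qed

theorem pointwise_ergodic:
  fixes f :: "'a \<Rightarrow> real"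
  assumes temp: "tempered_seq G F" and erg: "ergodic_measure G T M"
    and f: "f \<in> borel_measurable M" "\<And>x. x \<in> space M \<Longrightarrow> \<bar>f x\<bar> \<le> B"
  shows "AE x in M. (\<lambda>k. real_avg T (F k) f x) \<longlonglongrightarrow> (\<integral>x. f x \<partial>M)"
proof -
  define m where "m = (\<integral>x. f x \<partial>M)"
  have int: "integrable M f" using f by (rule integrable_bounded)
  have "AE x in M. (\<lambda>k. real_avg T (F k) (\<lambda>x. f x - m) x) \<longlonglongrightarrow> 0"
  proof (rule AE_real_avg_tendsto_0[OF temp erg])
    show "\<bar>f x - m\<bar> \<le> B + \<bar>m\<bar>" if "x \<in> space M" for x
      using f(2)[OF that] by linarith
    show "(\<integral>x. f x - m \<partial>M) = 0" using int by (simp add: m_def prob_space)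
  qed (use f(1) in measurable)
  then show ?thesis
  proof eventually_elim
    case (elim x)
    have "(\<lambda>k. real_avg T (F k) (\<lambda>x. f x - m) x + m) \<longlonglongrightarrow> 0 + m"
      using elim by (intro tendsto_intros)
    \<comment> \<open>Averaging the constant \<open>m\<close> over a finite set returns
      \<open>m\<close> only if the set is nonempty, hence the restriction to
      \<open>k \<ge> 1\<close>.\<close>
    moreover have "\<forall>\<^sub>F k in sequentially. real_avg T (F k) (\<lambda>x. f x - m) x + m = real_avg T (F k) f x"
      using eventually_ge_at_top[of 1]
    proof eventually_elim
      case (elim k)
      then have "card (F k) > 0" using folner_sets[OF elim] by (simp add: card_gt_0_iff)
      then show ?case unfolding real_avg_def by (simp add: sum_subtractf field_simps)
    qed
    ultimately show ?case unfolding m_def by (simp add: tendsto_cong)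
  qed
qed

end

section \<open>Generic points of a compact metric space\<close>

text \<open>A finite cover by balls becomes a partition when each point is sent to the least index
  of a ball containing it. The cells are the fibres of \<open>idx\<close>, each a ball minus
  finitely many balls or empty, and \<open>s j\<close> is within \<open>e\<close> of every point of
  cell \<open>j\<close>.\<close>

lemma compact_fine_index:
  fixes e :: real
  assumes "compact (UNIV :: 'x::metric_space set)" and e: "e > 0"
  shows "\<exists>(p::nat) (s :: nat \<Rightarrow> 'x) (idx :: 'x \<Rightarrow> nat).
           (\<forall>x. idx x < p \<and> dist x (s (idx x)) < e) \<and> (\<forall>j. {x. idx x = j} \<in> sets borel)"
proof -
  obtain C :: "'x set" where C: "finite C" "UNIV \<subseteq> (\<Union>x\<in>C. ball x e)"
    using assms compactE_image[of UNIV UNIV "\<lambda>x. ball x e"]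
    by (metis UNIV_I UN_I centre_in_ball open_ball subsetI)
  obtain s where s: "C = s ` {i::nat. i < card C}"
    using finite_imp_nat_seg_image_inj_on[OF C(1)] by (metis card_image card_Collect_less_nat)
  define P where "P = (\<lambda>j x. j < card C \<and> dist x (s j) < e)"
  define idx where "idx = (\<lambda>x. LEAST j. P j x)"
  have ex: "\<exists>j. P j x" for x
  proof -
    have "x \<in> (\<Union>c\<in>C. ball c e)" using C(2) by blast
    then obtain c where c: "c \<in> C" "dist x c < e" by (auto simp: dist_commute)
    obtain j where "j < card C" "c = s j" using c(1) by (subst (asm) s) auto
    then show ?thesis unfolding P_def using c(2) by blast
  qed
  have "P (idx x) x" for x unfolding idx_def using ex by (rule LeastI_ex)
  then have 1: "idx x < card C \<and> dist x (s (idx x)) < e" for x unfolding P_def by blast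
  have Pm: "{x. P j x} \<in> sets borel" for j
  proof -
    have "{x. P j x} = (if j < card C then ball (s j) e else {})"
      unfolding P_def by (auto simp: dist_commute)
    then show ?thesis by simp
  qed
  have "{x. idx x = j} \<in> sets borel" for j
  proof -
    have "idx x = j \<longleftrightarrow> P j x \<and> (\<forall>i<j. \<not> P i x)" for x
    proof
      assume j: "idx x = j"
      have "P j x" using LeastI_ex[OF ex[of x]] j unfolding idx_def by simp
      moreover have "\<not> P i x" if "i < j" for i
        using not_less_Least[of i "\<lambda>j. P j x"] j that unfolding idx_def by simp
      ultimately show "P j x \<and> (\<forall>i<j. \<not> P i x)" by blast
    next
      assume "P j x \<and> (\<forall>i<j. \<not> P i x)"
      then show "idx x = j"
        unfolding idx_def by (intro Least_equality) (use not_less in blast)+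
    qed
    then have "{x. idx x = j} = {x. P j x} - (\<Union>i<j. {x. P i x})" by auto
    then show ?thesis using Pm by auto
  qed
  then show ?thesis using 1 by blast
qed

lemma compact_fine_index_seq:
  assumes "compact (UNIV :: 'x::metric_space set)"
  obtains p :: "nat \<Rightarrow> nat" and s :: "nat \<Rightarrow> nat \<Rightarrow> 'x::metric_space"
    and idx :: "nat \<Rightarrow> 'x \<Rightarrow> nat"
  where "\<And>i x. idx i x < p i" "\<And>i x. dist x (s i (idx i x)) < 1 / Suc i"
    "\<And>i j. {x. idx i x = j} \<in> sets borel"
proof -
  have "\<forall>i. \<exists>(p::nat) (s :: nat \<Rightarrow> 'x) (idx :: 'x \<Rightarrow> nat).
      (\<forall>x. idx x < p \<and> dist x (s (idx x)) < 1 / Suc i) \<and> (\<forall>j. {x. idx x = j} \<in> sets borel)"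
    using compact_fine_index[OF assms] by simp
  then show ?thesis using that by metis
qed

text \<open>Points lying in some null cell form a null set, as there are countably many cells. For
  any other point, a fine enough cell containing it has positive measure and fits inside the given
  ball. This positivity keeps \<open>alpha\<close> from dividing by zero.\<close>

lemma AE_measure_ball_pos:
  fixes M :: "'x::metric_space measure"
  assumes cpt: "compact (UNIV :: 'x set)" and "finite_measure M" and M: "sets M = sets borel"
  shows "AE x in M. \<forall>e>0. measure M (ball x e) > 0"
proof -
  interpret finite_measure M by fact
  obtain p :: "nat \<Rightarrow> nat" and s :: "nat \<Rightarrow> nat \<Rightarrow> 'x" and idx where
    idx: "\<And>i x. dist x (s i (idx i x)) < 1 / Suc i" "\<And>i j. {x. idx i x = j} \<in> sets borel"
    using compact_fine_index_seq[OF cpt] by metis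
  have "AE x in M. idx i x = j \<longrightarrow> measure M {y. idx i y = j} > 0" for i j
  proof (cases "measure M {y. idx i y = j} = 0")
    case True
    then have "{y. idx i y = j} \<in> null_sets M"
      using idx(2) M by (simp add: null_sets_def emeasure_eq_measure)
    then have "AE x in M. x \<notin> {y. idx i y = j}" by (rule AE_not_in)
    then show ?thesis by eventually_elim simp
  next
    case False
    then have "measure M {y. idx i y = j} > 0" by (simp add: zero_less_measure_iff)
    then show ?thesis by simp
  qed
  then have "AE x in M. \<forall>i j. idx i x = j \<longrightarrow> measure M {y. idx i y = j} > 0"
    unfolding AE_all_countable by blast
  then show ?thesis
  proof eventually_elim
    case (elim x)
    show ?case
    proof (intro allI impI)
      fix e :: real assume "e > 0"
      then obtain i where i: "1 / real (Suc i) < e / 2" using nat_approx_posE[of "e / 2"] by auto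
      have "{y. idx i y = idx i x} \<subseteq> ball x e"
      proof
        fix y assume "y \<in> {y. idx i y = idx i x}"
        then have "dist y (s i (idx i x)) < 1 / Suc i" using idx(1)[of y i] by simp
        then have "dist x y < e"
          using idx(1)[of x i] dist_triangle2[of x y "s i (idx i x)"] i by linarith
        then show "y \<in> ball x e" by simp
      qed
      then have "measure M {y. idx i y = idx i x} \<le> measure M (ball x e)"
        using M by (intro finite_measure_mono) auto
      then show "measure M (ball x e) > 0" using elim by (blast intro: less_le_trans)
    qed
  qed
qed

text \<open>The bound may vary with \<open>g\<close>, so that a few exceptional \<open>g\<close> can
  carry a crude estimate. Two functions and two points are allowed, to cover both approximation and
  oscillation.\<close>

lemma norm_Avg_diff_le:
  assumes "finite K" "K \<noteq> {}" and "\<And>g. g \<in> K \<Longrightarrow> norm (f (T g x) - h (T g y)) \<le> e g"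
  shows "norm (Avg T K f x - Avg T K h y) \<le> sum e K / card K"
proof -
  have "Avg T K f x - Avg T K h y = (\<Sum>g\<in>K. f (T g x) - h (T g y)) / of_nat (card K)"
    unfolding Avg_def by (simp add: sum_subtractf diff_divide_distrib)
  also have "norm \<dots> \<le> (\<Sum>g\<in>K. norm (f (T g x) - h (T g y))) / card K"
    by (simp add: norm_divide divide_right_mono norm_sum)
  also have "\<dots> \<le> sum e K / card K"
    using assms by (intro divide_right_mono sum_mono) auto
  finally show ?thesis .
qed

text \<open>The null set must serve all continuous \<open>f\<close> at once, so it comes from
  countably many cell indicators. Uniform continuity then approximates each \<open>f\<close>
  uniformly by a function constant on the cells of one partition.\<close>

lemma AE_generic:
  fixes M :: "'x::metric_space measure"
  assumes cpt: "compact (UNIV :: 'x set)" and M: "sets M = sets borel"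
    and act: "folner_action M G T F"
    and temp: "tempered_seq G F" and erg: "ergodic_measure G T M"
  shows "AE x in M. \<forall>f. continuous_on UNIV f \<longrightarrow> (\<lambda>k. Avg T (F k) f x) \<longlonglongrightarrow> (\<integral>y. f y \<partial>M)"
proof -
  interpret folner_action M G T F by (rule act)
  have sp: "space M = UNIV" using sets_eq_imp_space_eq[OF M] by simp
  obtain p :: "nat \<Rightarrow> nat" and s :: "nat \<Rightarrow> nat \<Rightarrow> 'x" and idx where
    idx: "\<And>i x. idx i x < p i" "\<And>i x. dist x (s i (idx i x)) < 1 / Suc i"
      "\<And>i j. {x :: 'x. idx i x = j} \<in> sets borel"
    by (rule compact_fine_index_seq[OF cpt]) blast
  define A where "A = (\<lambda>i j. {x. idx i x = j})"
  have A[measurable]: "A i j \<in> sets M" for i j using idx(3) M unfolding A_def by simp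
  have "AE x in M. (\<lambda>k. real_avg T (F k) (indicator (A i j)) x) \<longlonglongrightarrow> measure M (A i j)" for i j
  proof -
    have "AE x in M. (\<lambda>k. real_avg T (F k) (indicator (A i j)) x) \<longlonglongrightarrow> (\<integral>x. indicator (A i j) x \<partial>M)"
      by (intro pointwise_ergodic[OF temp erg, where B = 1]) (auto simp: indicator_def)
    then show ?thesis by (simp add: sp)
  qed
  then have "AE x in M. \<forall>i j. (\<lambda>k. real_avg T (F k) (indicator (A i j)) x) \<longlonglongrightarrow> measure M (A i j)"
    by (simp add: AE_all_countable)
  then show ?thesis
  proof eventually_elim
    case (elim x)
    show ?case
    proof (intro allI impI)
      fix f :: "'x \<Rightarrow> complex"
      assume f: "continuous_on UNIV f"
      have ucont: "uniformly_continuous_on UNIV f"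
        using f cpt by (rule compact_uniformly_continuous)
      have "bounded (range f)"
        using compact_imp_bounded[OF compact_continuous_image[OF f cpt]] .
      then obtain B where B: "\<And>y. norm (f y) \<le> B" by (auto simp: bounded_iff)
      have fm[measurable]: "f \<in> borel_measurable M"
        using borel_measurable_continuous_onI[OF f] measurable_cong_sets[OF M refl] by blast
      have fi: "integrable M f" using B by (intro integrable_const_bound[where B = B]) auto
      show "(\<lambda>k. Avg T (F k) f x) \<longlonglongrightarrow> (\<integral>y. f y \<partial>M)"
      proof (rule LIMSEQ_I)
        fix \<epsilon> :: real assume e: "\<epsilon> > 0"
        then obtain d where d: "d > 0" "\<And>y z. dist y z < d \<Longrightarrow> dist (f y) (f z) < \<epsilon> / 4"
          using ucont[unfolded uniformly_continuous_on_def, rule_format, of "\<epsilon> / 4"] by auto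
        obtain i where i: "1 / real (Suc i) < d" using nat_approx_posE[OF d(1)] by auto
        \<comment> \<open>\<open>f'\<close> samples \<open>f\<close> at the cell centres; its
          averages and its integral are the same finite combination of visit frequencies and of
          measures of cells.\<close>
        define f' where "f' = (\<lambda>y. f (s i (idx i y)))"
        have close: "norm (f y - f' y) \<le> \<epsilon> / 4" for y
          using d(2)[of y "s i (idx i y)"] idx(2)[of y i] i unfolding f'_def by (simp add: dist_norm)
        have f'_eq: "f' y = (\<Sum>j<p i. f (s i j) * of_real (indicator (A i j) y))" for y
        proof -
          have "(\<Sum>j<p i. f (s i j) * of_real (indicator (A i j) y)) = (\<Sum>j<p i. if idx i y = j then f (s i j) else 0)"
            unfolding A_def by (intro sum.cong refl) auto
          also have "\<dots> = f' y" using idx(1) unfolding f'_def by simp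
          finally show ?thesis by simp
        qed
        have Ai: "integrable M (\<lambda>y. f (s i j) * of_real (indicator (A i j) y))" for j
          by (intro integrable_const_bound[where B = B]) (auto simp: indicator_def B order_trans[OF norm_ge_zero B])
        have f'i: "integrable M f'" unfolding f'_eq using Ai by simp
        have "(\<integral>y. f' y \<partial>M) = (\<Sum>j<p i. \<integral>y. f (s i j) * of_real (indicator (A i j) y) \<partial>M)"
          unfolding f'_eq using Ai by simp
        also have "\<dots> = (\<Sum>j<p i. f (s i j) * of_real (measure M (A i j)))"
          by (simp add: sp)
        finally have int_f': "(\<integral>y. f' y \<partial>M) = (\<Sum>j<p i. f (s i j) * of_real (measure M (A i j)))" .
        have avg_f': "Avg T K f' x = (\<Sum>j<p i. f (s i j) * of_real (real_avg T K (indicator (A i j)) x))" for K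
        proof -
          have "Avg T K f' x = (\<Sum>g\<in>K. \<Sum>j<p i. f (s i j) * of_real (indicator (A i j) (T g x))) / of_nat (card K)"
            unfolding Avg_def f'_eq by simp
          also have "\<dots> = (\<Sum>j<p i. \<Sum>g\<in>K. f (s i j) * of_real (indicator (A i j) (T g x))) / of_nat (card K)"
            by (subst sum.swap) simp
          also have "\<dots> = (\<Sum>j<p i. f (s i j) * of_real (real_avg T K (indicator (A i j)) x))"
            unfolding real_avg_def by (simp add: sum_divide_distrib sum_distrib_left)
          finally show ?thesis .
        qed
        have "(\<lambda>k. Avg T (F k) f' x) \<longlonglongrightarrow> (\<integral>y. f' y \<partial>M)"
          unfolding avg_f' int_f' using elim by (intro tendsto_intros) auto
        then have "\<forall>\<^sub>F k in sequentially. dist (Avg T (F k) f' x) (\<integral>y. f' y \<partial>M) < \<epsilon> / 4"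
          using e by (intro tendstoD) auto
        then obtain N where N: "\<And>k. k \<ge> N \<Longrightarrow> norm (Avg T (F k) f' x - (\<integral>y. f' y \<partial>M)) < \<epsilon> / 4"
          by (auto simp: eventually_sequentially dist_norm)
        have "norm ((\<integral>y. f' y \<partial>M) - (\<integral>y. f y \<partial>M)) = norm (\<integral>y. f' y - f y \<partial>M)"
          using fi f'i by simp
        also have "\<dots> \<le> (\<integral>y. norm (f' y - f y) \<partial>M)" by (rule integral_norm_bound)
        also have "\<dots> \<le> (\<integral>y. \<epsilon> / 4 \<partial>M)"
          using fi f'i close by (intro integral_mono) (auto simp: norm_minus_commute)
        finally have int_close: "norm ((\<integral>y. f' y \<partial>M) - (\<integral>y. f y \<partial>M)) \<le> \<epsilon> / 4" by (simp add: prob_space)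
        \<comment> \<open>Three errors of at most \<open>\<epsilon> / 4\<close>: replacing
          \<open>f\<close> by \<open>f'\<close> in the average, convergence for \<open>f'\<close>,
          and returning to \<open>f\<close> in the integral.\<close>
        show "\<exists>N. \<forall>k\<ge>N. norm (Avg T (F k) f x - (\<integral>y. f y \<partial>M)) < \<epsilon>"
        proof (intro exI allI impI)
          fix k assume k: "k \<ge> Suc N"
          then have Fk: "finite (F k)" "F k \<noteq> {}" using folner_sets[of k] by auto
          have "norm (Avg T (F k) f x - Avg T (F k) f' x) \<le> (\<Sum>g\<in>F k. \<epsilon> / 4) / card (F k)"
            using Fk close by (intro norm_Avg_diff_le) auto
          also have "\<dots> = \<epsilon> / 4" using Fk by simp
          finally have "norm (Avg T (F k) f x - Avg T (F k) f' x) \<le> \<epsilon> / 4" .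
          moreover have "norm (Avg T (F k) f' x - (\<integral>y. f' y \<partial>M)) < \<epsilon> / 4" using N k by simp
          moreover have "norm (Avg T (F k) f x - (\<integral>y. f y \<partial>M)) \<le>
              norm (Avg T (F k) f x - Avg T (F k) f' x) + norm (Avg T (F k) f' x - (\<integral>y. f' y \<partial>M))
              + norm ((\<integral>y. f' y \<partial>M) - (\<integral>y. f y \<partial>M))"
            using norm_triangle_ineq[of "Avg T (F k) f x - Avg T (F k) f' x + (Avg T (F k) f' x - (\<integral>y. f' y \<partial>M))" "(\<integral>y. f' y \<partial>M) - (\<integral>y. f y \<partial>M)"]
              norm_triangle_ineq[of "Avg T (F k) f x - Avg T (F k) f' x" "Avg T (F k) f' x - (\<integral>y. f' y \<partial>M)"]
            by simp
          ultimately show "norm (Avg T (F k) f x - (\<integral>y. f y \<partial>M)) < \<epsilon>"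
            using int_close e by linarith
        qed
      qed
    qed
  qed
qed

lemma norm_alpha_diff_le:
  assumes "finite_measure M" and E: "E \<in> sets M" "measure M E > 0" and g: "integrable M g"
    and le: "\<And>y. y \<in> E \<Longrightarrow> norm (g y - c) \<le> e"
  shows "norm (alpha M E g - c) \<le> e"
proof -
  interpret finite_measure M by fact
  have gi: "set_integrable M E g"
    using E(1) g unfolding set_integrable_def by (intro integrable_mult_indicator)
  have ci: "set_integrable M E (\<lambda>_. c)"
    using E(1) unfolding set_integrable_def by (intro integrable_mult_indicator) auto
  have ei: "set_integrable M E (\<lambda>_. e)"
    using E(1) unfolding set_integrable_def by (intro integrable_mult_indicator) auto
  have cint: "(LINT x:E|M. c) = of_real (measure M E) * c"
    using E(1) by (simp add: set_lebesgue_integral_def scaleR_conv_of_real)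
  have "norm ((LINT x:E|M. g x) - of_real (measure M E) * c) = norm (LINT x:E|M. g x - c)"
    using gi ci cint by simp
  also have "\<dots> \<le> (LINT x:E|M. norm (g x - c))"
    using set_integral_norm_bound[of M E "\<lambda>x. g x - c"] gi ci by simp
  also have "\<dots> \<le> (LINT x:E|M. e)"
    using gi ci ei le by (intro set_integral_mono) (auto intro: set_integrable_norm)
  also have "\<dots> = e * measure M E"
    using E(1) by (simp add: set_lebesgue_integral_def)
  finally have *: "norm ((LINT x:E|M. g x) - of_real (measure M E) * c) \<le> e * measure M E" .
  have "alpha M E g - c = ((LINT x:E|M. g x) - of_real (measure M E) * c) / of_real (measure M E)"
    unfolding alpha_def using E(2) by (simp add: field_simps)
  then have "norm (alpha M E g - c) = norm ((LINT x:E|M. g x) - of_real (measure M E) * c) / measure M E"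
    using E(2) by (simp add: norm_divide)
  then show ?thesis using * E(2) by (simp add: divide_le_eq)
qed

section \<open>Averages over shrinking balls\<close>

text \<open>For \<open>g\<close> outside the bad set, the Hoelder estimate sends \<open>x\<close>
  and \<open>y\<close> to points at distance at most \<open>d\<close>, where \<open>f\<close> varies
  by at most \<open>e\<close>; for bad \<open>g\<close> only \<open>2 * B\<close> is available. The
  proportion of bad \<open>g\<close> is the quantity that \<open>decays_fast\<close> sends to
  zero.\<close>

lemma Avg_oscillation_le:
  fixes T :: "'g \<Rightarrow> 'x::metric_space \<Rightarrow> 'x"
  assumes hold: "holder_modulus G T H L"
    and K: "finite K" "K \<noteq> {}" "K \<subseteq> carrier G"
    and B: "\<And>z. norm (f z) \<le> B" and e: "e \<ge> 0"
    and uc: "\<And>y z. dist y z \<le> d \<Longrightarrow> norm (f y - f z) \<le> e"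
    and r: "dist y x \<le> r"
  shows "norm (Avg T K f y - Avg T K f x)
           \<le> e + 2 * B * (real (card {g \<in> K. L g * r powr H g > d}) / card K)"
proof -
  let ?bad = "{g \<in> K. L g * r powr H g > d}"
  have B0: "B \<ge> 0" using B norm_ge_zero order_trans by blast
  have "norm (f (T g y) - f (T g x)) \<le> e + 2 * B * indicator ?bad g" if g: "g \<in> K" for g
  proof (cases "g \<in> ?bad")
    case True
    have "norm (f (T g y) - f (T g x)) \<le> B + B"
      using norm_triangle_ineq4 B by (meson add_mono order_trans)
    then show ?thesis using True e by simp
  next
    case False
    have Hg: "H g > 0" "L g > 0" "dist (T g y) (T g x) \<le> L g * dist y x powr H g"
      using hold g K(3) unfolding holder_modulus_def by auto
    have "dist (T g y) (T g x) \<le> L g * r powr H g"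
      using Hg r by (intro order_trans[OF Hg(3)] mult_left_mono powr_mono2) auto
    also have "\<dots> \<le> d" using False g by auto
    finally show ?thesis using uc False by simp
  qed
  then have "norm (Avg T K f y - Avg T K f x) \<le> (\<Sum>g\<in>K. e + 2 * B * indicator ?bad g) / card K"
    using K by (intro norm_Avg_diff_le) auto
  also have "(\<Sum>g\<in>K. e + 2 * B * indicator ?bad g) = card K * e + 2 * B * card ?bad"
    using K(1) by (simp add: sum.distrib sum_distrib_left[symmetric] indicator_def sum.If_cases Int_def)
  also have "\<dots> / card K = e + 2 * B * (real (card ?bad) / card K)"
    using K by (simp add: add_divide_distrib)
  finally show ?thesis .
qed

theorem corollary2p10:
  fixes G :: "('g, 'b) monoid_scheme"
    and T :: "'g \<Rightarrow> 'x::metric_space \<Rightarrow> 'x"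
    and H L :: "'g \<Rightarrow> real"
    and F :: "nat \<Rightarrow> 'g set"
    and \<mu> :: "'x measure"
    and n :: nat
  assumes "compact (UNIV :: 'x set)"
    and "group G"
    and "group_action G (UNIV :: 'x set) T"
    and "\<forall>g\<in>carrier G. \<exists>S. homeomorphism UNIV UNIV (T g) S"
    and "holder_modulus G T H L"
    and "amenable G"
    and "folner_seq G F"
    and "tempered_seq G F"
    and "sets \<mu> = sets borel"
    and "prob_space \<mu>"
    and "invariant_measure G T \<mu>"
    and "ergodic_measure G T \<mu>"
    and "n \<ge> 1"
  shows "AE x in Pi\<^sub>M {1..n} (\<lambda>_. \<mu>).
           \<forall>(f :: 'x \<Rightarrow> complex) (r :: nat \<Rightarrow> nat \<Rightarrow> real).
             continuous_on UNIV f \<longrightarrow>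
             (\<forall>k\<ge>1. \<forall>h\<in>{1..n}. r k h > 0) \<longrightarrow>
             decays_fast H L F n r \<longrightarrow>
             (\<lambda>k. alpha \<mu> (multi_ball n x (r k)) (Avg T (F k) f)) \<longlonglongrightarrow> (\<integral>y. f y \<partial>\<mu>)"
proof -
  interpret prob_space \<mu> by fact
  have sp: "space \<mu> = UNIV" using sets_eq_imp_space_eq[OF assms(9)] by simp
  have Tm: "T g \<in> measurable \<mu> \<mu>" if "g \<in> carrier G" for g
  proof -
    have "continuous_on UNIV (T g)" using assms(4) that unfolding homeomorphism_def by blast
    then have "T g \<in> measurable borel borel" by (rule borel_measurable_continuous_onI)
    then show ?thesis using measurable_cong_sets[OF assms(9) assms(9)] by blast
  qed
  have act: "folner_action \<mu> G T F"
  proof (intro folner_action.intro pmp_action.intro folner_action_axioms.intro pmp_action_axioms.intro)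
    show "group_action G (space \<mu>) T" using assms(3) sp by simp
    show "distr \<mu> \<mu> (T g) = \<mu>" if g: "g \<in> carrier G" for g
    proof (rule measure_eqI)
      fix A assume "A \<in> sets (distr \<mu> \<mu> (T g))"
      then have "A \<in> sets \<mu>" by simp
      then show "emeasure (distr \<mu> \<mu> (T g)) A = emeasure \<mu> A"
        using assms(11) g Tm[OF g] unfolding invariant_measure_def by (simp add: emeasure_distr)
    qed simp
  qed (use assms Tm in auto)
  interpret folner_action \<mu> G T F by (rule act)
  \<comment> \<open>Neither property involves the radii, and the second covers all \<open>f\<close>,
    so the null set is fixed before \<open>f\<close> and \<open>r\<close> are chosen.\<close>
  have gen: "AE x in \<mu>. (\<forall>e>0. measure \<mu> (ball x e) > 0) \<and>
      (\<forall>f. continuous_on UNIV f \<longrightarrow> (\<lambda>k. Avg T (F k) f x) \<longlonglongrightarrow> (\<integral>y. f y \<partial>\<mu>))"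
    using AE_measure_ball_pos[OF assms(1) finite_measure_axioms assms(9)]
      AE_generic[OF assms(1) assms(9) act assms(8) assms(12)] by eventually_elim blast
  \<comment> \<open>A null set in one factor pulls back to a null set of the product, and only
    \<open>n\<close> of these are united.\<close>
  have "AE x in Pi\<^sub>M {1..n} (\<lambda>_. \<mu>). \<forall>h\<in>{1..n}. (\<forall>e>0. measure \<mu> (ball (x h) e) > 0) \<and>
      (\<forall>f. continuous_on UNIV f \<longrightarrow> (\<lambda>k. Avg T (F k) f (x h)) \<longlonglongrightarrow> (\<integral>y. f y \<partial>\<mu>))"
    using gen by (intro AE_finite_allI AE_PiM_component) (auto intro: assms(10))
  then show ?thesis
  proof eventually_elim
    case (elim x)
    show ?case
    proof (intro allI impI)
      fix f :: "'x \<Rightarrow> complex" and r :: "nat \<Rightarrow> nat \<Rightarrow> real"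
      assume f: "continuous_on UNIV f" and r: "\<forall>k\<ge>1. \<forall>h\<in>{1..n}. r k h > 0"
        and fast: "decays_fast H L F n r"
      define I where "I = (\<integral>y. f y \<partial>\<mu>)"
      have ucont: "uniformly_continuous_on UNIV f"
        using f assms(1) by (rule compact_uniformly_continuous)
      have "bounded (range f)"
        using compact_imp_bounded[OF compact_continuous_image[OF f assms(1)]] .
      then obtain B where B: "\<And>y. norm (f y) \<le> B" by (auto simp: bounded_iff)
      have fm: "f \<in> borel_measurable \<mu>"
        using borel_measurable_continuous_onI[OF f] measurable_cong_sets[OF assms(9) refl] by blast
      have fi: "integrable \<mu> f" using B fm by (intro integrable_const_bound[where B = B]) auto
      show "(\<lambda>k. alpha \<mu> (multi_ball n x (r k)) (Avg T (F k) f)) \<longlonglongrightarrow> (\<integral>y. f y \<partial>\<mu>)"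
        unfolding I_def[symmetric]
      proof (rule LIMSEQ_I)
        fix \<epsilon> :: real assume e: "\<epsilon> > 0"
        then obtain d where d: "d > 0" "\<And>y z. dist y z < d \<Longrightarrow> dist (f y) (f z) < \<epsilon> / 4"
          using ucont[unfolded uniformly_continuous_on_def, rule_format, of "\<epsilon> / 4"] by auto
        \<comment> \<open>Halving \<open>d\<close> turns the strict modulus into the nonstrict one
          that the oscillation bound expects.\<close>
        have uc: "norm (f y - f z) \<le> \<epsilon> / 4" if "dist y z \<le> d / 2" for y z
          using d(2)[of y z] d(1) that by (simp add: dist_norm)
        let ?p = "\<lambda>k h. real (card {g \<in> F k. L g * r k h powr H g > d / 2}) / card (F k)"
        have "\<forall>\<^sub>F k in sequentially. \<forall>h\<in>{1..n}.
            2 * B * ?p k h < \<epsilon> / 4 \<and> dist (Avg T (F k) f (x h)) I < \<epsilon> / 4"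
        proof (intro eventually_ball_finite ballI eventually_conj)
          fix h assume h: "h \<in> {1..n}"
          have "(\<lambda>k. ?p k h) \<longlonglongrightarrow> 0"
            using fast[unfolded decays_fast_def, rule_format, OF h, THEN conjunct2] half_gt_zero[OF d(1)] by blast
          then have "(\<lambda>k. 2 * B * ?p k h) \<longlonglongrightarrow> 0" by (rule tendsto_mult_right_zero)
          then show "\<forall>\<^sub>F k in sequentially. 2 * B * ?p k h < \<epsilon> / 4"
            using e by (intro order_tendstoD(2)) auto
          have "(\<lambda>k. Avg T (F k) f (x h)) \<longlonglongrightarrow> I" using elim h f unfolding I_def by blast
          then show "\<forall>\<^sub>F k in sequentially. dist (Avg T (F k) f (x h)) I < \<epsilon> / 4"
            using e by (intro tendstoD) auto
        qed simp
        then obtain N where N: "\<And>k h. k \<ge> N \<Longrightarrow> h \<in> {1..n} \<Longrightarrow>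
            2 * B * ?p k h < \<epsilon> / 4 \<and> dist (Avg T (F k) f (x h)) I < \<epsilon> / 4"
          unfolding eventually_sequentially by blast
        show "\<exists>N. \<forall>k\<ge>N. norm (alpha \<mu> (multi_ball n x (r k)) (Avg T (F k) f) - I) < \<epsilon>"
        proof (intro exI allI impI)
          \<comment> \<open>\<open>Suc N\<close> forces \<open>k \<ge> 1\<close>, where the radii
            are positive and \<open>F k\<close> is constrained.\<close>
          fix k assume k: "k \<ge> Suc N"
          then have k1: "k \<ge> 1" by simp
          have Fk: "finite (F k)" "F k \<noteq> {}" "F k \<subseteq> carrier G" using folner_sets[OF k1] by auto
          let ?E = "multi_ball n x (r k)"
          have E: "?E \<in> sets \<mu>" unfolding assms(9) multi_ball_def by (intro borel_open open_UN) auto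
          \<comment> \<open>The first ball exists because \<open>n \<ge> 1\<close>; its positive
            measure makes \<open>alpha\<close> a genuine mean.\<close>
          have "measure \<mu> (ball (x 1) (r k 1)) > 0" using elim r k1 assms(13) by auto
          moreover have "measure \<mu> (ball (x 1) (r k 1)) \<le> measure \<mu> ?E"
            using E assms(13) unfolding multi_ball_def by (intro finite_measure_mono) auto
          ultimately have pos: "measure \<mu> ?E > 0" by linarith
          have ai: "integrable \<mu> (Avg T (F k) f)"
          proof -
            have "integrable \<mu> (\<lambda>y. f (T g y))" if "g \<in> F k" for g
              using that Fk fi by (intro integrable_action) auto
            then show ?thesis unfolding Avg_def by auto
          qed
          \<comment> \<open>One \<open>\<epsilon> / 4\<close> each for the good \<open>g\<close>,
            for the share of bad \<open>g\<close>, and for convergence at the centre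
            \<open>x h\<close> of a ball containing \<open>y\<close>.\<close>
          have "norm (Avg T (F k) f y - I) \<le> 3 * \<epsilon> / 4" if y: "y \<in> ?E" for y
          proof -
            obtain h where h: "h \<in> {1..n}" "dist y (x h) < r k h"
              using y unfolding multi_ball_def by (auto simp: dist_commute)
            have "norm (Avg T (F k) f y - Avg T (F k) f (x h)) \<le> \<epsilon> / 4 + 2 * B * ?p k h"
              using h(2) e uc by (intro Avg_oscillation_le[OF assms(5) Fk B]) auto
            moreover have "2 * B * ?p k h < \<epsilon> / 4" "norm (Avg T (F k) f (x h) - I) < \<epsilon> / 4"
              using N[of k h] k h by (auto simp: dist_norm)
            moreover have "norm (Avg T (F k) f y - I)
                \<le> norm (Avg T (F k) f y - Avg T (F k) f (x h)) + norm (Avg T (F k) f (x h) - I)"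
              using norm_triangle_ineq[of "Avg T (F k) f y - Avg T (F k) f (x h)" "Avg T (F k) f (x h) - I"] by simp
            ultimately show ?thesis by linarith
          qed
          from norm_alpha_diff_le[OF finite_measure_axioms E pos ai this]
          show "norm (alpha \<mu> ?E (Avg T (F k) f) - I) < \<epsilon>" using e by linarith
        qed
      qed
    qed
  qed
qed

end
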